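(* Let $X$ be a Banach space and let $\mathcal{U}=\{U(t,s)\}_{t\ge s\ge 0}$ be a nonuniform exponentially bounded evolution family on $X$. Each $C_0$-semigroup $\mathcal{T}_\alpha=\{T_\alpha(t)\}_{t\ge 0}$ on $\mathcal{C}(\mathcal{U},\alpha)$, $\alpha\in\mathcal{A}(\mathcal{U})$, with generator $G_{\mathcal{U},\alpha}$, satisfies the identity $$e^{t\sigma(G_{\mathcal{U},\alpha})}=\sigma(T_\alpha(t))\smallsetminus\{0\},\qquad t\ge 0.$$ Moreover, $\sigma(G_{\mathcal{U},\alpha})$ is a left half-plane and $\sigma(T_\alpha(t))$, $t\ge 0$, is a disc.
   Context: $\mathbb{R}_+=[0,\infty)$, and $C(\mathbb{R}_+,X)$ is the space of all continuous functions $\mathbb{R}_+\to X$. An evolution family (on the half-line) is a family $\mathcal{U}=\{U(t,s)\}_{t\ge s\ge 0}$ of bounded linear operators on $X$ such that $U(t,t)=\mathrm{Id}$ for $t\ge 0$; $U(t,\tau)U(\tau,s)=U(t,s)$ for $t\ge\tau\ge s\ge 0$; and the map $(t,s)\mapsto U(t,s)x$ is continuous for every $x\in X$. A number $\alpha\in\mathbb{R}$ is an admissible exponent of $\mathcal{U}$ if there is a continuous map $M_\alpha:\mathbb{R}_+\to(0,\infty)$ with $\|U(t,s)\|\le M_\alpha(s)e^{\alpha(t-s)}$ for all $t\ge s\ge 0$. $\mathcal{A}(\mathcal{U})$ is the set of all admissible exponents, and $\mathcal{U}$ is nonuniform exponentially bounded if $\mathcal{A}(\mathcal{U})\ne\emptyset$.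 For $\alpha\in\mathcal{A}(\mathcal{U})$, $t\ge 0$ and $u\in C(\mathbb{R}_+,X)$, put $\varphi_{\mathcal{U},\alpha}(t,u)=\sup_{\tau\ge t}e^{-\alpha(\tau-t)}\|U(\tau,t)u(t)\|$. The admissible Banach function space corresponding to $\mathcal{U}$ and $\alpha$ is $$\mathcal{C}(\mathcal{U},\alpha)=\{u\in C(\mathbb{R}_+,X):\ \lim_{t\to\infty}\varphi_{\mathcal{U},\alpha}(t,u)=\|u(0)\|=0\},$$ which is a Banach space with the norm $\|u\|_{\mathcal{U},\alpha}=\sup_{t\ge 0}\varphi_{\mathcal{U},\alpha}(t,u)$. On it, the formula $(T_\alpha(t)u)(s)=U(s,s-t)u(s-t)$ if $s>t$, and $(T_\alpha(t)u)(s)=0$ if $0\le s\le t$, defines a $C_0$-semigroup $\mathcal{T}_\alpha=\{T_\alpha(t)\}_{t\ge 0}$; its infinitesimal generator is denoted $G_{\mathcal{U},\alpha}$ (i.e. $G_{\mathcal{U},\alpha}u=\lim_{t\to 0_+}\frac{T_\alpha(t)u-u}{t}$, with domain the set of $u$ for which this limit exists in $\mathcal{C}(\mathcal{U},\alpha)$). $\sigma(\cdot)$ denotes the spectrum, a subset of $\mathbb{C}$, and $e^{tS}=\{e^{t\lambda}:\lambda\in S\}$ for $S\subset\mathbb{C}$.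
   Formalization: The identity at t = 0 is asserted only when σ(G) is nonempty, the empty set counts as a (degenerate) left half-plane, discs may have radius 0, and the disc claim assumes X ≠ {0}; the statement fails otherwise, e.g. for U(t,s) = exp(s²-t²) on X = ℂ. *)

theory Defs
  imports "HOL-Analysis.Analysis"
begin

text \<open>Complex Banach spaces: a (real) Banach space together with a compatible complex scalar
  multiplication for which the norm is absolutely homogeneous.\<close>

class cbanach = banach +
  fixes scaleC :: "complex \<Rightarrow> 'a \<Rightarrow> 'a" (infixr "*\<^sub>C" 75)
  assumes scaleC_add_right: "c *\<^sub>C (x + y) = c *\<^sub>C x + c *\<^sub>C y"
    and scaleC_add_left: "(c + d) *\<^sub>C x = c *\<^sub>C x + d *\<^sub>C x"
    and scaleC_scaleC: "c *\<^sub>C (d *\<^sub>C x) = (c * d) *\<^sub>C x"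
    and scaleC_of_real: "complex_of_real r *\<^sub>C x = r *\<^sub>R x"
    and norm_scaleC: "norm (c *\<^sub>C x) = cmod c * norm x"

instantiation complex :: cbanach
begin

definition scaleC_complex :: "complex \<Rightarrow> complex \<Rightarrow> complex" where
  "scaleC_complex c x = c * x"

instance
  by standard (auto simp: scaleC_complex_def algebra_simps norm_mult scaleR_conv_of_real)

end

definition bounded_clinear :: "('a::cbanach \<Rightarrow> 'b::cbanach) \<Rightarrow> bool" where
  "bounded_clinear f \<longleftrightarrow> bounded_linear f \<and> (\<forall>c x. f (c *\<^sub>C x) = c *\<^sub>C f x)"

text \<open>The spaces below are carriers \<open>V\<close> of functions with pointwise vector space operations and a
  norm \<open>N\<close>; an operator on such a space is given by its domain \<open>D\<close> and its action \<open>A\<close>.\<close>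

definition resolvent_set ::
  "('i \<Rightarrow> 'a::cbanach) set \<Rightarrow> (('i \<Rightarrow> 'a) \<Rightarrow> real) \<Rightarrow> ('i \<Rightarrow> 'a) set \<Rightarrow> (('i \<Rightarrow> 'a) \<Rightarrow> ('i \<Rightarrow> 'a))
    \<Rightarrow> complex set" where
  "resolvent_set V N D A =
    {z. bij_betw (\<lambda>u i. z *\<^sub>C u i - A u i) D V \<and>
        (\<exists>K. \<forall>u\<in>D. N u \<le> K * N (\<lambda>i. z *\<^sub>C u i - A u i))}"

definition spectrum ::
  "('i \<Rightarrow> 'a::cbanach) set \<Rightarrow> (('i \<Rightarrow> 'a) \<Rightarrow> real) \<Rightarrow> ('i \<Rightarrow> 'a) set \<Rightarrow> (('i \<Rightarrow> 'a) \<Rightarrow> ('i \<Rightarrow> 'a))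
    \<Rightarrow> complex set" where
  "spectrum V N D A = - resolvent_set V N D A"

definition is_generator_value ::
  "('i \<Rightarrow> 'a::cbanach) set \<Rightarrow> (('i \<Rightarrow> 'a) \<Rightarrow> real) \<Rightarrow> (real \<Rightarrow> ('i \<Rightarrow> 'a) \<Rightarrow> ('i \<Rightarrow> 'a))
    \<Rightarrow> ('i \<Rightarrow> 'a) \<Rightarrow> ('i \<Rightarrow> 'a) \<Rightarrow> bool" where
  "is_generator_value V N T u v \<longleftrightarrow>
    v \<in> V \<and> ((\<lambda>h. N (\<lambda>i. (1 / h) *\<^sub>R (T h u i - u i) - v i)) \<longlongrightarrow> 0) (at_right 0)"

definition generator_domain ::
  "('i \<Rightarrow> 'a::cbanach) set \<Rightarrow> (('i \<Rightarrow> 'a) \<Rightarrow> real) \<Rightarrow> (real \<Rightarrow> ('i \<Rightarrow> 'a) \<Rightarrow> ('i \<Rightarrow> 'a))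
    \<Rightarrow> ('i \<Rightarrow> 'a) set" where
  "generator_domain V N T = {u\<in>V. \<exists>v. is_generator_value V N T u v}"

definition generator ::
  "('i \<Rightarrow> 'a::cbanach) set \<Rightarrow> (('i \<Rightarrow> 'a) \<Rightarrow> real) \<Rightarrow> (real \<Rightarrow> ('i \<Rightarrow> 'a) \<Rightarrow> ('i \<Rightarrow> 'a))
    \<Rightarrow> ('i \<Rightarrow> 'a) \<Rightarrow> ('i \<Rightarrow> 'a)" where
  "generator V N T u = (THE v. is_generator_value V N T u v)"

definition evolution_family :: "(real \<Rightarrow> real \<Rightarrow> 'a::cbanach \<Rightarrow> 'a) \<Rightarrow> bool" where
  "evolution_family U \<longleftrightarrow>
    (\<forall>t s. 0 \<le> s \<and> s \<le> t \<longrightarrow> bounded_clinear (U t s)) \<and>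
    (\<forall>t\<ge>0. U t t = id) \<and>
    (\<forall>t r s. 0 \<le> s \<and> s \<le> r \<and> r \<le> t \<longrightarrow> U t r \<circ> U r s = U t s) \<and>
    (\<forall>x. continuous_on {(t, s). 0 \<le> s \<and> s \<le> t} (\<lambda>(t, s). U t s x))"

definition admissible_exponents :: "(real \<Rightarrow> real \<Rightarrow> 'a::cbanach \<Rightarrow> 'a) \<Rightarrow> real set" where
  "admissible_exponents U =
    {\<alpha>. \<exists>M. continuous_on {0..} M \<and> (\<forall>s\<ge>0. M s > 0) \<and>
        (\<forall>t s. 0 \<le> s \<and> s \<le> t \<longrightarrow> onorm (U t s) \<le> M s * exp (\<alpha> * (t - s)))}"

definition nonuniform_exponentially_bounded :: "(real \<Rightarrow> real \<Rightarrow> 'a::cbanach \<Rightarrow> 'a) \<Rightarrow> bool" where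
  "nonuniform_exponentially_bounded U \<longleftrightarrow> admissible_exponents U \<noteq> {}"

definition adm_phi ::
  "(real \<Rightarrow> real \<Rightarrow> 'a::cbanach \<Rightarrow> 'a) \<Rightarrow> real \<Rightarrow> real \<Rightarrow> (real \<Rightarrow> 'a) \<Rightarrow> real" where
  "adm_phi U \<alpha> t u = (SUP \<tau>\<in>{t..}. exp (- \<alpha> * (\<tau> - t)) * norm (U \<tau> t (u t)))"

text \<open>A function on the half-line is represented by its extension by zero to the negative reals, so
  that equality of functions is equality on the half-line.\<close>

definition adm_space ::
  "(real \<Rightarrow> real \<Rightarrow> 'a::cbanach \<Rightarrow> 'a) \<Rightarrow> real \<Rightarrow> (real \<Rightarrow> 'a) set" where
  "adm_space U \<alpha> =
    {u. continuous_on {0..} u \<and> (\<forall>t<0. u t = 0) \<and>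
        ((\<lambda>t. adm_phi U \<alpha> t u) \<longlongrightarrow> 0) at_top \<and> norm (u 0) = 0}"

definition adm_norm ::
  "(real \<Rightarrow> real \<Rightarrow> 'a::cbanach \<Rightarrow> 'a) \<Rightarrow> real \<Rightarrow> (real \<Rightarrow> 'a) \<Rightarrow> real" where
  "adm_norm U \<alpha> u = (SUP t\<in>{0..}. adm_phi U \<alpha> t u)"

text \<open>The formula does not involve the exponent; the exponent only enters through the space on
  which the semigroup acts. For negative \<open>s\<close> the value is zero, as the representation requires.\<close>

definition evolution_semigroup ::
  "(real \<Rightarrow> real \<Rightarrow> 'a::cbanach \<Rightarrow> 'a) \<Rightarrow> real \<Rightarrow> (real \<Rightarrow> 'a) \<Rightarrow> (real \<Rightarrow> 'a)" where
  "evolution_semigroup U t u = (\<lambda>s. if s > t then U s (s - t) (u (s - t)) else 0)"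

definition spectrum_semigroup ::
  "(real \<Rightarrow> real \<Rightarrow> 'a::cbanach \<Rightarrow> 'a) \<Rightarrow> real \<Rightarrow> real \<Rightarrow> complex set" where
  "spectrum_semigroup U \<alpha> t =
    spectrum (adm_space U \<alpha>) (adm_norm U \<alpha>) (adm_space U \<alpha>) (evolution_semigroup U t)"

definition spectrum_generator ::
  "(real \<Rightarrow> real \<Rightarrow> 'a::cbanach \<Rightarrow> 'a) \<Rightarrow> real \<Rightarrow> complex set" where
  "spectrum_generator U \<alpha> =
    spectrum (adm_space U \<alpha>) (adm_norm U \<alpha>)
      (generator_domain (adm_space U \<alpha>) (adm_norm U \<alpha>) (evolution_semigroup U))
      (generator (adm_space U \<alpha>) (adm_norm U \<alpha>) (evolution_semigroup U))"

text \<open>The empty set is the degenerate half-plane with abscissa minus infinity. It does occur: for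
  the scalar family \<open>U t s x = exp (s\<^sup>2 - t\<^sup>2) *\<^sub>R x\<close> every
  semigroup operator with \<open>t > 0\<close> is quasinilpotent, and the generator has empty spectrum.\<close>

definition is_left_half_plane :: "complex set \<Rightarrow> bool" where
  "is_left_half_plane S \<longleftrightarrow> S = {} \<or> (\<exists>\<omega>::real. S = {z. Re z \<le> \<omega>})"

text \<open>Discs of radius zero are allowed: the spectrum of the identity is a single point.\<close>

definition is_disc :: "complex set \<Rightarrow> bool" where
  "is_disc S \<longleftrightarrow> (\<exists>c r. r \<ge> 0 \<and> S = cball c r)"

end

theory Submission
  imports Defs "HOL-Real_Asymp.Real_Asymp"
begin

text \<open>
  Equip the fibre over \<open>s\<close> with the Lyapunov norm
  \<open>lyap s x = sup\<^bsub>t \<ge> s\<^esub> exp (-\<alpha> (t - s)) \<parallel>U t s x\<parallel>\<close>. The space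
  consists of the continuous sections that vanish at \<open>0\<close> and at infinity in these norms, and its
  norm is the supremum of the fibre norms. Although \<open>U\<close> may grow nonuniformly in the given norm,
  it satisfies \<open>lyap t (U t s x) \<le> exp (\<alpha> (t - s)) lyap s x\<close>. Both spectra are governed by
  the set of all \<open>\<omega>\<close> for which such a bound holds with \<open>\<omega>\<close> in place of \<open>\<alpha>\<close>, up
  to a constant factor (the predicate \<open>growth \<omega>\<close>). Precisely, \<open>\<mu>\<close> is in the resolvent
  set of the generator iff \<open>growth \<omega>\<close> for some \<open>\<omega> < Re \<mu>\<close>, and for \<open>t > 0\<close> a
  number \<open>z \<noteq> 0\<close> is in the resolvent set of \<open>T t\<close> iff \<open>growth \<omega>\<close> for some
  \<open>\<omega>\<close> with \<open>exp (\<omega> t) < |z|\<close>. With the infimum of these \<open>\<omega>\<close> as abscissa, the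
  half-plane, the disc and the spectral mapping identity can be read off; the abscissa
  \<open>-\<infinity>\<close> gives the empty half-plane and the disc \<open>{0}\<close>. For \<open>t > 0\<close> the point \<open>0\<close>
  belongs to the spectrum of \<open>T t\<close> because every function in the range of \<open>T t\<close> vanishes on
  \<open>[0, t]\<close>.

  What makes the half-line special is that \<open>T r f s = 0\<close> for \<open>r \<ge> s\<close>. Hence the formulas
  \<open>\<integral> exp (-\<mu> r) T r f s dr\<close> and \<open>\<Sum> z\<^sup>-\<^sup>k\<^sup>-\<^sup>1 T (k t) f s\<close> for the two resolvents make sense
  pointwise for all \<open>\<mu>\<close> and all \<open>z \<noteq> 0\<close>, whether or not they converge in norm. They are always
  left inverses (\<open>laplace_resolvent_of_gen_value\<close>,
  \<open>discrete_resolvent_left_inverse\<close>), so that a point is in the resolvent set iff its formula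
  gives a bounded operator on the space whose values solve the resolvent equation.

  If the growth bound holds, the formulas are dominated by a convergent exponential integral or
  geometric series, and they are bounded. Conversely, let the formula be bounded and apply it to a
  rescaled orbit \<open>\<tau> \<mapsto> exp (-\<mu> (\<tau> - a)) U \<tau> a x\<close> that is cut off outside an interval of
  length \<open>l\<close>. Beyond this interval the result is again the rescaled orbit, multiplied by a number
  that grows linearly in \<open>l\<close>. So the rescaled orbit is bounded by its initial value, and then it
  even decays by a fixed factor after a fixed time
  (\<open>growth_from_orbit_estimates\<close>), which gives an exponent strictly below \<open>Re \<mu>\<close>.
\<close>

section \<open>Complex scalars and two facts of real analysis\<close>

interpretation scaleC: bounded_bilinear "(*\<^sub>C) :: complex \<Rightarrow> 'a::cbanach \<Rightarrow> 'a"
proof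
  fix a a' :: complex and b b' :: 'a and r :: real
  show "(a + a') *\<^sub>C b = a *\<^sub>C b + a' *\<^sub>C b" by (rule scaleC_add_left)
  show "a *\<^sub>C (b + b') = a *\<^sub>C b + a *\<^sub>C b'" by (rule scaleC_add_right)
  show "(r *\<^sub>R a) *\<^sub>C b = r *\<^sub>R (a *\<^sub>C b)"
    by (simp add: scaleC_scaleC[symmetric] scaleC_of_real scaleR_conv_of_real)
  show "a *\<^sub>C (r *\<^sub>R b) = r *\<^sub>R (a *\<^sub>C b)"
    by (simp add: scaleC_of_real[symmetric] scaleC_scaleC mult.commute)
  show "\<exists>K. \<forall>a (b::'a). norm (a *\<^sub>C b) \<le> norm a * norm b * K"
    by (rule exI[of _ 1]) (simp add: norm_scaleC)
qed

lemma scaleC_one [simp]: "1 *\<^sub>C x = (x::'a::cbanach)"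
  using scaleC_of_real[of 1 x] by simp

text \<open>Continuity on a half-line is local, whereas integrals with a parameter and locally finite sums
  are handled on compact intervals.\<close>

lemma continuous_on_halfline:
  fixes f :: "real \<Rightarrow> 'b::topological_space"
  assumes "\<And>b. b > 0 \<Longrightarrow> continuous_on {0..b} f"
  shows "continuous_on {0..} f"
  unfolding continuous_on_def
proof
  fix x :: real assume x: "x \<in> {0..}"
  have "(f \<longlongrightarrow> f x) (at x within {0..x+1})"
    using assms[of "x+1"] x unfolding continuous_on_def by auto
  moreover have "at x within {0..x+1} = at x within {0..}"
    by (rule at_within_nhd[where S="{..<x+1}"]) auto
  ultimately show "(f \<longlongrightarrow> f x) (at x within {0..})" by simp
qed

text \<open>The generator provides difference quotients in one direction only. Since they converge
  uniformly and the limit is continuous, the backward quotient at a point is the forward quotient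
  at a nearby point, so that the function has a two-sided derivative.\<close>

lemma has_vector_derivative_from_uniform_forward_differences:
  fixes y g :: "real \<Rightarrow> 'b::real_normed_vector"
  assumes g: "continuous_on {a..b} g"
    and fwd: "\<And>e. e > 0 \<Longrightarrow> \<exists>d>0. \<forall>h r. 0 < h \<and> h < d \<and> a \<le> r \<and> r + h \<le> b \<longrightarrow>
               norm (y (r + h) - y r - h *\<^sub>R g r) \<le> e * h"
    and x: "x \<in> {a..b}"
  shows "(y has_vector_derivative g x) (at x within {a..b})"
  unfolding has_vector_derivative_def has_derivative_within_alt
proof (intro conjI allI impI)
  show "bounded_linear (\<lambda>h. h *\<^sub>R g x)" by (rule bounded_linear_scaleR_left)
  fix e :: real assume e: "e > 0"
  obtain d1 where d1: "d1 > 0" "\<And>h r. 0 < h \<Longrightarrow> h < d1 \<Longrightarrow> a \<le> r \<Longrightarrow> r + h \<le> b \<Longrightarrow>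
               norm (y (r + h) - y r - h *\<^sub>R g r) \<le> e/2 * h"
    using fwd[of "e/2"] e by auto
  obtain d2 where d2: "d2 > 0" "\<And>r. r \<in> {a..b} \<Longrightarrow> dist r x < d2 \<Longrightarrow> dist (g r) (g x) < e/2"
    using g x e unfolding continuous_on_iff by (metis half_gt_zero)
  have "norm (y z - y x - (z - x) *\<^sub>R g x) \<le> e * norm (z - x)"
    if z: "z \<in> {a..b}" "norm (z - x) < min d1 d2" for z
  proof -
    consider "z = x" | "z > x" | "z < x" by linarith
    then show ?thesis
    proof cases
      case 1 then show ?thesis by simp
    next
      case 2
      have "norm (y z - y x - (z - x) *\<^sub>R g x) \<le> e/2 * (z - x)"
        using d1(2)[of "z - x" x] z x 2 by auto
      then show ?thesis using 2 e by (smt (verit) mult_right_mono field_sum_of_halves norm_ge_zero real_norm_def)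
    next
      case 3
      have 1: "norm (y x - y z - (x - z) *\<^sub>R g z) \<le> e/2 * (x - z)"
        using d1(2)[of "x - z" z] z x 3 by auto
      have "norm (g z - g x) \<le> e/2" using d2(2)[of z] z by (auto simp: dist_norm less_imp_le)
      then have 2: "norm ((x - z) *\<^sub>R (g z - g x)) \<le> e/2 * (x - z)"
        using 3 by (simp add: mult.commute mult_left_mono)
      have "norm (y z - y x - (z - x) *\<^sub>R g x)
          = norm ((y x - y z - (x - z) *\<^sub>R g z) + (x - z) *\<^sub>R (g z - g x))"
        by (subst norm_minus_cancel[symmetric]) (simp add: algebra_simps)
      also have "\<dots> \<le> e/2 * (x - z) + e/2 * (x - z)"
        using norm_triangle_mono[OF 1 2] .
      finally show ?thesis using 3 by (simp add: algebra_simps)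
    qed
  qed
  then show "\<exists>d>0. \<forall>z\<in>{a..b}. norm (z - x) < d \<longrightarrow> norm (y z - y x - (z - x) *\<^sub>R g x) \<le> e * norm (z - x)"
    using d1 d2 by (intro exI[of _ "min d1 d2"]) auto
qed

section \<open>Evolution families with an admissible exponent\<close>

locale evolution_setting =
  fixes U :: "real \<Rightarrow> real \<Rightarrow> 'a::cbanach \<Rightarrow> 'a" and \<alpha> :: real and M :: "real \<Rightarrow> real"
  assumes ev: "evolution_family U"
    and M_cont: "continuous_on {0..} M"
    and U_onorm: "\<And>t s. 0 \<le> s \<Longrightarrow> s \<le> t \<Longrightarrow> onorm (U t s) \<le> M s * exp (\<alpha> * (t - s))"
begin

lemma U_bounded_linear: "0 \<le> s \<Longrightarrow> s \<le> t \<Longrightarrow> bounded_linear (U t s)"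
  using ev unfolding evolution_family_def bounded_clinear_def by blast

lemma U_scaleC: "0 \<le> s \<Longrightarrow> s \<le> t \<Longrightarrow> U t s (c *\<^sub>C x) = c *\<^sub>C U t s x"
  using ev unfolding evolution_family_def bounded_clinear_def by blast

lemma U_add: "0 \<le> s \<Longrightarrow> s \<le> t \<Longrightarrow> U t s (x + y) = U t s x + U t s y"
  using linear_add[OF bounded_linear.linear[OF U_bounded_linear]] .

lemma U_diff: "0 \<le> s \<Longrightarrow> s \<le> t \<Longrightarrow> U t s (x - y) = U t s x - U t s y"
  using linear_diff[OF bounded_linear.linear[OF U_bounded_linear]] .

lemma U_zero: "0 \<le> s \<Longrightarrow> s \<le> t \<Longrightarrow> U t s 0 = 0"
  using linear_0[OF bounded_linear.linear[OF U_bounded_linear]] .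

lemma U_refl: "0 \<le> t \<Longrightarrow> U t t x = x"
  using ev unfolding evolution_family_def by simp

lemma U_comp: "U t r (U r s x) = U t s x" if "0 \<le> s" "s \<le> r" "r \<le> t"
proof -
  have "U t r \<circ> U r s = U t s" using ev that unfolding evolution_family_def by blast
  then show ?thesis by (simp add: fun_eq_iff)
qed

lemma norm_U_le: "norm (U t s x) \<le> M s * exp (\<alpha> * (t - s)) * norm x" if "0 \<le> s" "s \<le> t"
  using onorm[OF U_bounded_linear[OF that], of x] U_onorm[OF that]
  by (meson mult_right_mono norm_ge_zero order_trans)

text \<open>Strong continuity in \<open>(t, s)\<close> becomes joint continuity in \<open>(t, s, x)\<close> because
  the operator norms are locally bounded by the continuous function \<open>M\<close>.\<close>

lemma continuous_on_U:
  fixes p q :: "'b::topological_space \<Rightarrow> real" and f :: "'b \<Rightarrow> 'a"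
  assumes p: "continuous_on S p" and q: "continuous_on S q" and f: "continuous_on S f"
    and le: "\<And>x. x \<in> S \<Longrightarrow> 0 \<le> q x \<and> q x \<le> p x"
  shows "continuous_on S (\<lambda>x. U (p x) (q x) (f x))"
  unfolding continuous_on_def
proof
  fix x0 assume x0: "x0 \<in> S"
  let ?F = "at x0 within S"
  have "continuous_on {(t, s). 0 \<le> s \<and> s \<le> t} (\<lambda>(t, s). U t s (f x0))"
    using ev unfolding evolution_family_def by blast
  from continuous_on_compose2[OF this continuous_on_Pair[OF p q]]
  have "continuous_on S (\<lambda>x. U (p x) (q x) (f x0))" using le by fastforce
  then have 1: "((\<lambda>x. U (p x) (q x) (f x0)) \<longlongrightarrow> U (p x0) (q x0) (f x0)) ?F"
    using x0 unfolding continuous_on_def by blast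
  have "continuous_on S (\<lambda>x. M (q x) * exp (\<alpha> * (p x - q x)) * norm (f x - f x0))"
    by (intro continuous_intros continuous_on_compose2[OF M_cont q] p q f) (use le in auto)
  then have "((\<lambda>x. M (q x) * exp (\<alpha> * (p x - q x)) * norm (f x - f x0)) \<longlongrightarrow> 0) ?F"
    using x0 unfolding continuous_on_def by force
  then have 2: "((\<lambda>x. U (p x) (q x) (f x - f x0)) \<longlongrightarrow> 0) ?F"
  proof (rule Lim_null_comparison[rotated])
    show "\<forall>\<^sub>F x in ?F. norm (U (p x) (q x) (f x - f x0))
        \<le> M (q x) * exp (\<alpha> * (p x - q x)) * norm (f x - f x0)"
      using le norm_U_le by (auto simp: eventually_at_filter)
  qed
  have "((\<lambda>x. U (p x) (q x) (f x - f x0) + U (p x) (q x) (f x0)) \<longlongrightarrow> 0 + U (p x0) (q x0) (f x0)) ?F"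
    by (rule tendsto_add[OF 2 1])
  moreover have "\<forall>\<^sub>F x in ?F. U (p x) (q x) (f x - f x0) + U (p x) (q x) (f x0) = U (p x) (q x) (f x)"
    using le by (auto simp: eventually_at_filter U_diff)
  ultimately show "((\<lambda>x. U (p x) (q x) (f x)) \<longlongrightarrow> U (p x0) (q x0) (f x0)) ?F"
    by (auto elim: Lim_transform_eventually)
qed

section \<open>The Lyapunov norm of a fibre\<close>

definition lyap :: "real \<Rightarrow> 'a \<Rightarrow> real" where
  "lyap s x = adm_phi U \<alpha> s (\<lambda>_. x)"

lemma adm_phi_eq_lyap: "adm_phi U \<alpha> t u = lyap t (u t)"
  by (simp add: lyap_def adm_phi_def)

lemma lyap_weighted_orbit_le_M:
  assumes "0 \<le> s" "s \<le> t"
  shows "exp (- \<alpha> * (t - s)) * norm (U t s x) \<le> M s * norm x"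
proof -
  have "exp (- \<alpha> * (t - s)) * norm (U t s x) \<le> exp (- \<alpha> * (t - s)) * (M s * exp (\<alpha> * (t - s)) * norm x)"
    by (intro mult_left_mono norm_U_le assms) auto
  also have "\<dots> = M s * norm x * (exp (- \<alpha> * (t - s)) * exp (\<alpha> * (t - s)))" by simp
  also have "\<dots> = M s * norm x" by (simp flip: exp_add)
  finally show ?thesis .
qed

lemma bdd_above_lyap: "0 \<le> s \<Longrightarrow> bdd_above ((\<lambda>t. exp (- \<alpha> * (t - s)) * norm (U t s x)) ` {s..})"
  using lyap_weighted_orbit_le_M by (intro bdd_aboveI2[where M="M s * norm x"]) auto

lemma lyap_upper: "0 \<le> s \<Longrightarrow> s \<le> t \<Longrightarrow> exp (- \<alpha> * (t - s)) * norm (U t s x) \<le> lyap s x"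
  unfolding lyap_def adm_phi_def by (intro cSUP_upper bdd_above_lyap) auto

lemma lyap_least: 
  assumes "\<And>t. t \<ge> s \<Longrightarrow> exp (- \<alpha> * (t - s)) * norm (U t s x) \<le> b"
  shows "lyap s x \<le> b"
  unfolding lyap_def adm_phi_def using assms by (intro cSUP_least) auto

lemma lyap_le_M: "0 \<le> s \<Longrightarrow> lyap s x \<le> M s * norm x"
  by (intro lyap_least lyap_weighted_orbit_le_M)

lemma norm_le_lyap: "0 \<le> s \<Longrightarrow> norm x \<le> lyap s x"
  using lyap_upper[of s s x] by (simp add: U_refl)

lemma lyap_nonneg: "0 \<le> s \<Longrightarrow> 0 \<le> lyap s x"
  using norm_le_lyap[of s x] norm_ge_zero[of x] by linarith

lemma lyap_zero: "0 \<le> s \<Longrightarrow> lyap s 0 = 0"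
  using lyap_le_M[of s 0] lyap_nonneg[of s 0] by simp

lemma lyap_add: "0 \<le> s \<Longrightarrow> lyap s (x + y) \<le> lyap s x + lyap s y"
proof (rule lyap_least)
  fix t assume s: "0 \<le> s" "s \<le> t"
  have "exp (- \<alpha> * (t - s)) * norm (U t s (x + y))
      \<le> exp (- \<alpha> * (t - s)) * (norm (U t s x) + norm (U t s y))"
    unfolding U_add[OF s] by (intro mult_left_mono norm_triangle_ineq) auto
  also have "\<dots> \<le> lyap s x + lyap s y"
    using lyap_upper[OF s, of x] lyap_upper[OF s, of y] by (simp add: distrib_left)
  finally show "exp (- \<alpha> * (t - s)) * norm (U t s (x + y)) \<le> lyap s x + lyap s y" .
qed

lemma lyap_scaleC_le: "0 \<le> s \<Longrightarrow> lyap s (c *\<^sub>C x) \<le> cmod c * lyap s x"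
proof (rule lyap_least)
  fix t assume s: "0 \<le> s" "s \<le> t"
  have "cmod c * (exp (- \<alpha> * (t - s)) * norm (U t s x)) \<le> cmod c * lyap s x"
    by (intro mult_left_mono lyap_upper s) auto
  then show "exp (- \<alpha> * (t - s)) * norm (U t s (c *\<^sub>C x)) \<le> cmod c * lyap s x"
    unfolding U_scaleC[OF s] norm_scaleC by (simp add: mult_ac)
qed

lemma lyap_scaleC: "lyap s (c *\<^sub>C x) = cmod c * lyap s x" if s: "0 \<le> s"
proof (cases "c = 0")
  case True then show ?thesis by (simp add: s lyap_zero scaleC.zero_left)
next
  case False
  have "lyap s x = lyap s (inverse c *\<^sub>C (c *\<^sub>C x))" using False by (simp add: scaleC_scaleC)
  also have "\<dots> \<le> cmod (inverse c) * lyap s (c *\<^sub>C x)" by (rule lyap_scaleC_le[OF s])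
  finally have "lyap s x \<le> inverse (cmod c) * lyap s (c *\<^sub>C x)" by (simp only: norm_inverse)
  then have "cmod c * lyap s x \<le> lyap s (c *\<^sub>C x)"
    using False by (simp add: field_simps)
  then show ?thesis using lyap_scaleC_le[OF s, of c x] by linarith
qed

lemma lyap_scaleR: "0 \<le> s \<Longrightarrow> lyap s (r *\<^sub>R x) = \<bar>r\<bar> * lyap s x"
  by (simp add: scaleC_of_real[symmetric] lyap_scaleC)

lemma lyap_diff: "0 \<le> s \<Longrightarrow> lyap s (x - y) \<le> lyap s x + lyap s y"
  using lyap_add[of s x "- y"] lyap_scaleR[of s "-1" y] by simp

lemma lyap_sum:
  assumes s: "0 \<le> s" and "finite I"
  shows "lyap s (\<Sum>i\<in>I. f i) \<le> (\<Sum>i\<in>I. lyap s (f i))"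
  using assms(2)
proof (induction I rule: finite_induct)
  case empty then show ?case by (simp add: lyap_zero s)
next
  case (insert i I)
  then show ?case using lyap_add[of s "f i" "\<Sum>i\<in>I. f i"] s by simp
qed

text \<open>This is the reason for changing the norms: the evolution family is uniformly exponentially
  bounded between Lyapunov norms, with constant one.\<close>

lemma lyap_U_le: "lyap t (U t s x) \<le> exp (\<alpha> * (t - s)) * lyap s x" if "0 \<le> s" "s \<le> t"
proof (rule lyap_least)
  fix r assume r: "t \<le> r"
  have "exp (- \<alpha> * (r - t)) * norm (U r t (U t s x)) 
      = exp (\<alpha> * (t - s)) * (exp (- \<alpha> * (r - s)) * norm (U r s x))"
  proof -
    have "exp (- \<alpha> * (r - t)) = exp (\<alpha> * (t - s)) * exp (- \<alpha> * (r - s))"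
      unfolding exp_add[symmetric] by (simp add: algebra_simps)
    then show ?thesis using that r by (simp add: U_comp)
  qed
  also have "\<dots> \<le> exp (\<alpha> * (t - s)) * lyap s x"
    using that r by (intro mult_left_mono lyap_upper) auto
  finally show "exp (- \<alpha> * (r - t)) * norm (U r t (U t s x)) \<le> exp (\<alpha> * (t - s)) * lyap s x" .
qed

text \<open>Each \<open>U t s\<close> can be pulled into the integral, and the bound by the majorant \<open>g\<close> does
  not depend on \<open>t\<close>; only then is the supremum over \<open>t\<close> taken.\<close>

lemma lyap_integral:
  fixes a b :: real
  assumes s: "0 \<le> s" and f: "continuous_on {a..b} f" and g: "g integrable_on {a..b}"
    and le: "\<And>r. r \<in> {a..b} \<Longrightarrow> lyap s (f r) \<le> g r"
  shows "lyap s (integral {a..b} f) \<le> integral {a..b} g"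
proof (rule lyap_least)
  fix t assume t: "s \<le> t"
  have int: "f integrable_on {a..b}" by (rule integrable_continuous_real[OF f])
  have "U t s (integral {a..b} f) = integral {a..b} (\<lambda>r. U t s (f r))"
    using integral_linear[OF int U_bounded_linear[OF s t]] unfolding o_def by (rule sym)
  then have "exp (- \<alpha> * (t - s)) * norm (U t s (integral {a..b} f))
      = norm (exp (- \<alpha> * (t - s)) *\<^sub>R integral {a..b} (\<lambda>r. U t s (f r)))"
    by (simp only: norm_scaleR abs_exp_cancel)
  also have "\<dots> = norm (integral {a..b} (\<lambda>r. exp (- \<alpha> * (t - s)) *\<^sub>R U t s (f r)))"
    by (simp only: integral_cmul)
  also have "\<dots> \<le> integral {a..b} g"
  proof (rule integral_norm_bound_integral[OF _ g])
    show "(\<lambda>r. exp (- \<alpha> * (t - s)) *\<^sub>R U t s (f r)) integrable_on {a..b}"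
      by (intro integrable_continuous_real continuous_on_scaleR continuous_on_const continuous_on_U f)
        (use s t in auto)
    fix r assume r: "r \<in> {a..b}"
    have "norm (exp (- \<alpha> * (t - s)) *\<^sub>R U t s (f r)) \<le> lyap s (f r)"
      using lyap_upper[OF s t, of "f r"] by simp
    then show "norm (exp (- \<alpha> * (t - s)) *\<^sub>R U t s (f r)) \<le> g r" using le[OF r] by linarith
  qed
  finally show "exp (- \<alpha> * (t - s)) * norm (U t s (integral {a..b} f)) \<le> integral {a..b} g" .
qed

section \<open>The function space and its norm\<close>

abbreviation "V \<equiv> adm_space U \<alpha>"
abbreviation "N \<equiv> adm_norm U \<alpha>"
abbreviation "T \<equiv> evolution_semigroup U"

lemma V_iff:
  "u \<in> V \<longleftrightarrow> continuous_on {0..} u \<and> (\<forall>t<0. u t = 0) \<and> ((\<lambda>t. lyap t (u t)) \<longlongrightarrow> 0) at_top \<and> u 0 = 0"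
  by (simp add: adm_space_def adm_phi_eq_lyap)

lemma V_intro:
  assumes "continuous_on {0..} u" "\<And>t. t < 0 \<Longrightarrow> u t = 0" "u 0 = 0"
    and "\<And>e. e > 0 \<Longrightarrow> \<exists>S. \<forall>t\<ge>S. t \<ge> 0 \<longrightarrow> lyap t (u t) \<le> e"
  shows "u \<in> V"
proof -
  have "((\<lambda>t. lyap t (u t)) \<longlongrightarrow> 0) at_top"
  proof (rule tendstoI)
    fix e :: real assume "e > 0"
    then obtain S where S: "\<forall>t\<ge>S. t \<ge> 0 \<longrightarrow> lyap t (u t) \<le> e/2" using assms(4)[of "e/2"] by auto
    have "dist (lyap t (u t)) 0 < e" if "t \<ge> max S 0" for t
      using S lyap_nonneg[of t "u t"] that \<open>e > 0\<close> by fastforce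
    then show "\<forall>\<^sub>F t in at_top. dist (lyap t (u t)) 0 < e"
      unfolding eventually_at_top_linorder by blast
  qed
  then show ?thesis using assms by (auto simp: V_iff)
qed

lemma V_tail:
  assumes "u \<in> V" "e > 0"
  obtains S where "S > 0" "\<And>t. t \<ge> S \<Longrightarrow> lyap t (u t) \<le> e"
proof -
  have "\<forall>\<^sub>F t in at_top. dist (lyap t (u t)) 0 < e" using assms tendstoD unfolding V_iff by blast
  then obtain S where S: "\<And>t. t \<ge> S \<Longrightarrow> \<bar>lyap t (u t)\<bar> < e"
    unfolding eventually_at_top_linorder by auto
  show ?thesis using S by (intro that[of "max S 1"]) (auto simp: abs_less_iff less_imp_le)
qed

lemma V_continuous: "u \<in> V \<Longrightarrow> continuous_on {0..} u" by (simp add: V_iff)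
lemma V_neg: "u \<in> V \<Longrightarrow> t < 0 \<Longrightarrow> u t = 0" by (simp add: V_iff)
lemma V_at_0: "u \<in> V \<Longrightarrow> u 0 = 0" by (simp add: V_iff)

lemma M_bounded_on_Icc: obtains B where "B > 0" "\<And>t. 0 \<le> t \<Longrightarrow> t \<le> S \<Longrightarrow> M t \<le> B"
proof -
  have "compact (M ` {0..S})"
    by (intro compact_continuous_image continuous_on_subset[OF M_cont]) auto
  then obtain B where "\<forall>y\<in>M ` {0..S}. norm y \<le> B" using compact_imp_bounded bounded_iff by blast
  then have "\<And>t. 0 \<le> t \<Longrightarrow> t \<le> S \<Longrightarrow> M t \<le> max B 1" by (force simp: le_max_iff_disj)
  then show ?thesis by (intro that[of "max B 1"]) auto
qed

text \<open>The supremum that defines the norm is finite: near infinity the fibre norms are small, and on a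
  compact interval they are dominated by \<open>M\<close> times the original norm.\<close>

lemma bdd_above_N: assumes u: "u \<in> V" shows "bdd_above ((\<lambda>t. lyap t (u t)) ` {0..})"
proof -
  obtain S where S: "S > 0" "\<And>t. t \<ge> S \<Longrightarrow> lyap t (u t) \<le> 1" using V_tail[OF u, of 1] by auto
  have "compact ((\<lambda>t. M t * norm (u t)) ` {0..S})"
    by (intro compact_continuous_image continuous_intros continuous_on_subset[OF M_cont]
        continuous_on_subset[OF V_continuous[OF u]]) auto
  then obtain B where B: "\<forall>y\<in>(\<lambda>t. M t * norm (u t)) ` {0..S}. norm y \<le> B"
    using compact_imp_bounded bounded_iff by blast
  have "lyap t (u t) \<le> max B 1" if "t \<ge> 0" for t
  proof (cases "t \<ge> S")
    case True then show ?thesis using S(2)[OF True] by linarith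
  next
    case False
    then have "norm (M t * norm (u t)) \<le> B" using B that by auto
    then show ?thesis using lyap_le_M[OF that, of "u t"] by auto
  qed
  then show ?thesis by (intro bdd_aboveI2) auto
qed

lemma lyap_le_N: "u \<in> V \<Longrightarrow> s \<ge> 0 \<Longrightarrow> lyap s (u s) \<le> N u"
  unfolding adm_norm_def adm_phi_eq_lyap by (intro cSUP_upper bdd_above_N) auto

lemma N_least: "(\<And>s. s \<ge> 0 \<Longrightarrow> lyap s (u s) \<le> b) \<Longrightarrow> N u \<le> b"
  unfolding adm_norm_def adm_phi_eq_lyap by (intro cSUP_least) auto

lemma norm_le_N: "u \<in> V \<Longrightarrow> s \<ge> 0 \<Longrightarrow> norm (u s) \<le> N u"
  using lyap_le_N norm_le_lyap order_trans by blast

lemma N_nonneg: "u \<in> V \<Longrightarrow> 0 \<le> N u"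
  using norm_le_N[of u 0] norm_ge_zero[of "u 0"] by linarith

lemma V_add: assumes "u \<in> V" "v \<in> V" shows "(\<lambda>i. u i + v i) \<in> V"
proof (rule V_intro)
  fix e :: real assume e: "e > 0"
  obtain S where S: "S > 0" "\<And>t. t \<ge> S \<Longrightarrow> lyap t (u t) \<le> e/2" using V_tail[OF assms(1), of "e/2"] e by auto
  obtain S' where S': "S' > 0" "\<And>t. t \<ge> S' \<Longrightarrow> lyap t (v t) \<le> e/2" using V_tail[OF assms(2), of "e/2"] e by auto
  have "lyap t (u t + v t) \<le> e" if "t \<ge> max S S'" for t
    using S(2)[of t] S'(2)[of t] S(1) lyap_add[of t "u t" "v t"] that by auto
  then show "\<exists>S. \<forall>t\<ge>S. t \<ge> 0 \<longrightarrow> lyap t (u t + v t) \<le> e" by blast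
qed (use assms in \<open>auto simp: V_iff intro!: continuous_on_add\<close>)

lemma V_scaleC: assumes "u \<in> V" shows "(\<lambda>i. c *\<^sub>C u i) \<in> V"
proof -
  have "((\<lambda>t. cmod c * lyap t (u t)) \<longlongrightarrow> cmod c * 0) at_top"
    using assms unfolding V_iff by (intro tendsto_mult tendsto_const) auto
  moreover have "\<forall>\<^sub>F t in at_top. cmod c * lyap t (u t) = lyap t (c *\<^sub>C u t)"
    using eventually_ge_at_top[of 0] by eventually_elim (simp add: lyap_scaleC)
  ultimately have "((\<lambda>t. lyap t (c *\<^sub>C u t)) \<longlongrightarrow> 0) at_top"
    by (auto elim: Lim_transform_eventually)
  then show ?thesis using assms
    by (auto simp: V_iff scaleC.zero_right intro!: scaleC.continuous_on continuous_on_const)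
qed

lemma V_scaleR: "u \<in> V \<Longrightarrow> (\<lambda>i. c *\<^sub>R u i) \<in> V"
  using V_scaleC[of u "of_real c"] by (simp add: scaleC_of_real)

lemma V_diff: "u \<in> V \<Longrightarrow> v \<in> V \<Longrightarrow> (\<lambda>i. u i - v i) \<in> V"
  using V_add[of u "\<lambda>i. (-1) *\<^sub>R v i"] V_scaleR[of v "-1"] by simp

section \<open>The evolution semigroup\<close>

lemma T_before: "s \<le> h \<Longrightarrow> T h u s = 0" by (simp add: evolution_semigroup_def)

lemma T_after: "h < s \<Longrightarrow> T h u s = U s (s - h) (u (s - h))" by (simp add: evolution_semigroup_def)

text \<open>Because \<open>u 0 = 0\<close>, the case distinction in the semigroup can be replaced by a truncated
  shift, which makes the joint continuity in time and place visible.\<close>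

lemma T_eq:
  assumes "u 0 = 0" "0 \<le> s" "0 \<le> h"
  shows "T h u s = U s (max (s - h) 0) (u (max (s - h) 0))"
  using assms U_zero[of 0 s] by (auto simp: evolution_semigroup_def max_def)

lemma T_continuous:
  fixes p q :: "'b::topological_space \<Rightarrow> real"
  assumes u: "u \<in> V" and p: "continuous_on S p" and q: "continuous_on S q"
    and "\<And>x. x \<in> S \<Longrightarrow> 0 \<le> p x" "\<And>x. x \<in> S \<Longrightarrow> 0 \<le> q x"
  shows "continuous_on S (\<lambda>x. T (p x) u (q x))"
proof -
  have "continuous_on S (\<lambda>x. U (q x) (max (q x - p x) 0) (u (max (q x - p x) 0)))"
    by (intro continuous_on_U continuous_intros p q continuous_on_compose2[OF V_continuous[OF u]])
      (use assms in auto)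
  then show ?thesis
    by (rule continuous_on_eq) (use assms V_at_0 in \<open>auto simp: T_eq\<close>)
qed

lemma lyap_T:
  assumes u: "u \<in> V" and "0 \<le> h" "0 \<le> s"
  shows "lyap s (T h u s) \<le> exp (\<alpha> * h) * lyap (max (s - h) 0) (u (max (s - h) 0))"
proof (cases "h < s")
  case True
  then show ?thesis using lyap_U_le[of "s - h" s "u (s - h)"] assms by (simp add: T_after)
next
  case False
  then show ?thesis using assms by (simp add: T_before lyap_zero lyap_nonneg)
qed

lemma T_in_V: assumes u: "u \<in> V" and h: "0 \<le> h" shows "T h u \<in> V"
proof (rule V_intro)
  show "continuous_on {0..} (T h u)"
    using T_continuous[OF u continuous_on_const continuous_on_id, of "{0..}" h] h by auto
  fix e :: real assume e: "e > 0"
  obtain S where S: "S > 0" "\<And>t. t \<ge> S \<Longrightarrow> lyap t (u t) \<le> e / exp (\<alpha> * h)"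
    using V_tail[OF u, of "e / exp (\<alpha> * h)"] e by auto
  have "lyap t (T h u t) \<le> e" if "t \<ge> S + h" for t
  proof -
    have "lyap t (T h u t) \<le> exp (\<alpha> * h) * lyap (t - h) (u (t - h))"
      using lyap_T[OF u h, of t] that S(1) h by (simp add: max_def)
    also have "\<dots> \<le> exp (\<alpha> * h) * (e / exp (\<alpha> * h))" using S that by (intro mult_left_mono) auto
    finally show ?thesis by simp
  qed
  then show "\<exists>S. \<forall>t\<ge>S. t \<ge> 0 \<longrightarrow> lyap t (T h u t) \<le> e" by blast
qed (use h T_before in auto)

lemma T_0: assumes "u \<in> V" shows "T 0 u = u"
proof
  fix s show "T 0 u s = u s"
    using assms by (cases s "0::real" rule: linorder_cases) (auto simp: T_before T_after U_refl V_iff)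
qed

lemma T_T: assumes "0 \<le> r" "0 \<le> h" shows "T r (T h u) s = T (r + h) u s"
  using assms by (auto simp: evolution_semigroup_def U_comp U_zero algebra_simps)

lemma T_add: "0 \<le> r \<Longrightarrow> T r (\<lambda>i. u i + v i) s = T r u s + T r v s"
  by (simp add: evolution_semigroup_def U_add)

lemma T_diff: "0 \<le> r \<Longrightarrow> T r (\<lambda>i. u i - v i) s = T r u s - T r v s"
  by (simp add: evolution_semigroup_def U_diff)

lemma T_scaleC: "0 \<le> r \<Longrightarrow> T r (\<lambda>i. c *\<^sub>C u i) s = c *\<^sub>C T r u s"
  by (simp add: evolution_semigroup_def U_scaleC scaleC.zero_right)

lemma T_scaleR: "0 \<le> r \<Longrightarrow> T r (\<lambda>i. c *\<^sub>R u i) s = c *\<^sub>R T r u s"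
  using T_scaleC[of r "of_real c" u s] by (simp add: scaleC_of_real)

lemma T_sum: "0 \<le> r \<Longrightarrow> T r (\<lambda>i. \<Sum>k\<in>I. u k i) s = (\<Sum>k\<in>I. T r (u k) s)"
proof (induction I rule: infinite_finite_induct)
  case (insert k I) then show ?case by (simp add: T_add)
qed (auto simp: evolution_semigroup_def U_zero)

text \<open>Far out, both \<open>T h u\<close> and \<open>u\<close> are small. On the remaining compact interval the Lyapunov
  norms are dominated by the original norm, and there \<open>T h u s\<close> is uniformly continuous in
  \<open>(h, s)\<close>.\<close>

lemma T_strongly_continuous:
  assumes u: "u \<in> V" and e: "e > 0"
  obtains d where "d > 0" "\<And>h. 0 \<le> h \<Longrightarrow> h < d \<Longrightarrow> N (\<lambda>s. T h u s - u s) \<le> e"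
proof -
  \<comment> \<open>far out the two terms contribute at most \<open>exp \<bar>\<alpha>\<bar> * c\<close> and \<open>c\<close>, which add up to \<open>e\<close>\<close>
  define c where "c = e / (exp \<bar>\<alpha>\<bar> + 1)"
  have c: "c > 0" "c \<le> e / (exp \<bar>\<alpha>\<bar> + 1)" using e by (auto simp: c_def add_pos_pos)
  obtain S where S: "S > 0" "\<And>t. t \<ge> S \<Longrightarrow> lyap t (u t) \<le> c" using V_tail[OF u c(1)] by auto
  obtain B where B: "B > 0" "\<And>t. 0 \<le> t \<Longrightarrow> t \<le> S + 1 \<Longrightarrow> M t \<le> B" using M_bounded_on_Icc by blast
  \<comment> \<open>a shift by at most 1 keeps \<open>s - h \<ge> S\<close> for \<open>s > S + 1\<close>\<close>
  have "continuous_on ({0..1} \<times> {0..S+1}) (\<lambda>x. T (fst x) u (snd x))"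
    by (intro T_continuous[OF u] continuous_intros) auto
  then have "uniformly_continuous_on ({0..1} \<times> {0..S+1}) (\<lambda>x. T (fst x) u (snd x))"
    by (rule compact_uniformly_continuous) (simp add: compact_Times)
  moreover have "e / B > 0" using e B by simp
  ultimately obtain d where d: "d > 0" "\<And>x y. x \<in> {0..1} \<times> {0..S+1} \<Longrightarrow> y \<in> {0..1} \<times> {0..S+1} \<Longrightarrow> dist y x < d
       \<Longrightarrow> dist (T (fst y) u (snd y)) (T (fst x) u (snd x)) < e / B"
    by (rule uniformly_continuous_onE) blast
  have "N (\<lambda>s. T h u s - u s) \<le> e" if h: "0 \<le> h" "h < min d 1" for h
  proof (rule N_least)
    fix s :: real assume s: "0 \<le> s"
    show "lyap s (T h u s - u s) \<le> e"
    proof (cases "s \<le> S + 1")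
      case True
      have "dist (T h u s) (T 0 u s) < e / B"
        using d(2)[of "(0, s)" "(h, s)"] h s True by (auto simp: dist_Pair_Pair)
      then have 1: "norm (T h u s - u s) \<le> e / B" by (simp add: T_0[OF u] dist_norm)
      have "lyap s (T h u s - u s) \<le> M s * norm (T h u s - u s)" by (rule lyap_le_M[OF s])
      also have "\<dots> \<le> B * (e / B)" using B(2)[OF s True] 1 B(1) by (intro mult_mono) auto
      finally show ?thesis using B(1) by simp
    next
      case False
      have "\<alpha> * h \<le> \<bar>\<alpha>\<bar> * 1" using h by (intro mult_mono) auto
      then have *: "exp (\<alpha> * h) \<le> exp \<bar>\<alpha>\<bar>" by simp
      have "lyap s (T h u s) \<le> exp (\<alpha> * h) * lyap (s - h) (u (s - h))"
        using lyap_T[OF u h(1) s] h False S by (simp add: max_def)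
      also have "\<dots> \<le> exp \<bar>\<alpha>\<bar> * c" using * S(2)[of "s - h"] h False S(1) lyap_nonneg[of "s - h"]
        by (intro mult_mono) auto
      finally have "lyap s (T h u s - u s) \<le> exp \<bar>\<alpha>\<bar> * c + c"
        using lyap_diff[OF s, of "T h u s" "u s"] S(2)[of s] False by linarith
      also have "\<dots> = (exp \<bar>\<alpha>\<bar> + 1) * c" by (simp add: distrib_right)
      also have "\<dots> = e" unfolding c_def by (smt (verit) exp_gt_zero nonzero_mult_div_cancel_left times_divide_eq_right)
      finally show ?thesis .
    qed
  qed
  then show ?thesis using d(1) by (intro that[of "min d 1"]) auto
qed

section \<open>Exponential growth in the Lyapunov norms\<close>

definition growth :: "real \<Rightarrow> bool" where
  "growth \<omega> \<longleftrightarrow> (\<exists>C\<ge>0. \<forall>a\<ge>0. \<forall>s\<ge>a. \<forall>x. lyap s (U s a x) \<le> C * exp (\<omega> * (s - a)) * lyap a x)"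

lemma growth_alpha: "growth \<alpha>"
  unfolding growth_def using lyap_U_le by (intro exI[of _ 1]) auto

lemma growth_lyap_T:
  assumes u: "u \<in> V" and "0 \<le> h" "0 \<le> s" "0 \<le> C"
    and C: "\<And>a s x. 0 \<le> a \<Longrightarrow> a \<le> s \<Longrightarrow> lyap s (U s a x) \<le> C * exp (\<omega> * (s - a)) * lyap a x"
    and B: "0 \<le> B" "h \<le> s \<Longrightarrow> lyap (s - h) (u (s - h)) \<le> B"
  shows "lyap s (T h u s) \<le> C * exp (\<omega> * h) * B"
proof (cases "h < s")
  case True
  have "lyap s (T h u s) \<le> C * exp (\<omega> * h) * lyap (s - h) (u (s - h))"
    using C[of "s - h" s "u (s - h)"] assms True by (simp add: T_after)
  also have "\<dots> \<le> C * exp (\<omega> * h) * B"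
    using B True assms by (intro mult_left_mono) auto
  finally show ?thesis .
next
  case False
  then show ?thesis using assms by (simp add: T_before lyap_zero)
qed

text \<open>Write \<open>g s = exp (-\<beta> (s - a)) lyap s (U s a x)\<close>. The hypothesis says that \<open>m\<close> times the
  later values of \<open>g\<close> are controlled by the values on an initial interval, for each \<open>m\<close> and
  with \<open>K\<close> independent of \<open>m\<close>. For \<open>m = 1\<close> this bounds \<open>g\<close> by a multiple of
  \<open>g a\<close>. Inserting this bound for a large \<open>m\<close> halves \<open>g\<close> after a time \<open>l\<close>, and
  since \<open>a\<close> and \<open>x\<close> are arbitrary the halving can be repeated. This is the argument of
  Datko's theorem.\<close>

lemma growth_from_orbit_estimates:
  assumes K: "K \<ge> 0"
    and est: "\<And>m::nat. \<exists>l>0. \<forall>a\<ge>0. \<forall>x. \<forall>s\<ge>a + l. \<forall>B.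
          (\<forall>\<tau>\<in>{a..a + l}. exp (- \<beta> * (\<tau> - a)) * lyap \<tau> (U \<tau> a x) \<le> B) \<longrightarrow>
          m * (exp (- \<beta> * (s - a)) * lyap s (U s a x)) \<le> K * B"
  shows "\<exists>\<omega><\<beta>. growth \<omega>"
proof -
  define g where "g a x s = exp (- \<beta> * (s - a)) * lyap s (U s a x)" for a x s
  have g_comp: "exp (- \<beta> * (r - a)) * g r (U r a x) s = g a x s" if "0 \<le> a" "a \<le> r" "r \<le> s" for a r s x
    using that unfolding g_def by (simp add: U_comp algebra_simps flip: exp_add)
  obtain l1 where l1: "l1 > 0" "\<And>a x s B. a \<ge> 0 \<Longrightarrow> s \<ge> a + l1 \<Longrightarrow> (\<forall>\<tau>\<in>{a..a + l1}. g a x \<tau> \<le> B) \<Longrightarrow> g a x s \<le> K * B"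
    using est[of 1] unfolding g_def by auto
  \<comment> \<open>on the initial interval the a priori exponent \<open>\<alpha>\<close> suffices\<close>
  define C1 where "C1 = exp (\<bar>\<alpha> - \<beta>\<bar> * l1)"
  have short: "g a x s \<le> C1 * lyap a x" if "0 \<le> a" "a \<le> s" "s \<le> a + l1" for a x s
  proof -
    have "g a x s \<le> exp (- \<beta> * (s - a)) * (exp (\<alpha> * (s - a)) * lyap a x)"
      unfolding g_def by (intro mult_left_mono lyap_U_le that) auto
    also have "\<dots> = exp ((\<alpha> - \<beta>) * (s - a)) * lyap a x" by (simp add: algebra_simps flip: exp_add)
    also have "\<dots> \<le> C1 * lyap a x"
    proof (intro mult_right_mono lyap_nonneg that)
      have "(\<alpha> - \<beta>) * (s - a) \<le> \<bar>\<alpha> - \<beta>\<bar> * l1" using that by (intro mult_mono) auto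
      then show "exp ((\<alpha> - \<beta>) * (s - a)) \<le> C1" by (simp add: C1_def)
    qed
    finally show ?thesis .
  qed
  define C where "C = max C1 (K * C1)"
  have C: "C > 0" by (simp add: C_def C1_def less_max_iff_disj)
  have bounded: "g a x s \<le> C * lyap a x" if "0 \<le> a" "a \<le> s" for a x s
  proof (cases "s \<le> a + l1")
    case True
    then show ?thesis using short[OF that True, of x] lyap_nonneg[OF that(1), of x]
      by (smt (verit) C_def mult_right_mono)
  next
    case False
    then have "g a x s \<le> K * (C1 * lyap a x)" using l1(2)[OF that(1)] short that by auto
    also have "\<dots> \<le> C * lyap a x" using lyap_nonneg[OF that(1), of x] unfolding C_def
      by (simp add: mult.assoc[symmetric] mult_right_mono)
    finally show ?thesis .
  qed
  \<comment> \<open>the choice of \<open>m\<close> makes \<open>K * C / m\<close> at most \<open>1/2\<close>\<close>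
  define m where "m = nat \<lceil>2 * K * C + 1\<rceil>"
  have m: "real m \<ge> 2 * K * C + 1" unfolding m_def by (rule real_nat_ceiling_ge)
  have m_pos: "real m > 0" using m K C by (smt (verit) mult_nonneg_nonneg)
  obtain l where l: "l > 0" "\<And>a x s B. a \<ge> 0 \<Longrightarrow> s \<ge> a + l \<Longrightarrow> (\<forall>\<tau>\<in>{a..a + l}. g a x \<tau> \<le> B) \<Longrightarrow> m * g a x s \<le> K * B"
    using est[of m] unfolding g_def by auto
  have half: "g a x s \<le> lyap a x / 2" if "0 \<le> a" "a + l \<le> s" for a x s
  proof -
    have "m * g a x s \<le> K * (C * lyap a x)" using l(2)[OF that] bounded that(1) by auto
    also have "\<dots> \<le> m * (lyap a x / 2)"
      using mult_right_mono[OF m, of "lyap a x"] lyap_nonneg[OF that(1), of x] by (simp add: algebra_simps)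
    finally show ?thesis using m_pos by simp
  qed
  have iterate: "g a x s \<le> C * (1/2) ^ n * lyap a x" if "0 \<le> a" "a + n * l \<le> s" for a x s and n :: nat
    using that
  proof (induction n arbitrary: a x)
    case 0 then show ?case using bounded[of a s x] by simp
  next
    case (Suc n)
    have "a + Suc n * l = a + l + n * l" by (simp add: algebra_simps)
    moreover have "0 \<le> n * l" using l(1) by simp
    ultimately have le: "a + l \<le> s" using Suc.prems(2) by linarith
    have "g (a + l) (U (a + l) a x) s \<le> C * (1/2) ^ n * lyap (a + l) (U (a + l) a x)"
      using Suc.prems l(1) by (intro Suc.IH) (auto simp: algebra_simps)
    then have "exp (- \<beta> * l) * g (a + l) (U (a + l) a x) s \<le> exp (- \<beta> * l) * (C * (1/2) ^ n * lyap (a + l) (U (a + l) a x))"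
      by (rule mult_left_mono) simp
    moreover have "exp (- \<beta> * l) * g (a + l) (U (a + l) a x) s = g a x s"
      using g_comp[of a "a + l" s x] Suc.prems l(1) le by simp
    ultimately have "g a x s \<le> exp (- \<beta> * l) * (C * (1/2) ^ n * lyap (a + l) (U (a + l) a x))" by (simp only:)
    also have "\<dots> = C * (1/2) ^ n * g a x (a + l)" by (simp add: g_def)
    also have "\<dots> \<le> C * (1/2) ^ n * (lyap a x / 2)"
      using half[of a "a + l" x] Suc.prems C by (intro mult_left_mono) auto
    finally show ?case by simp
  qed
  \<comment> \<open>a factor \<open>1/2\<close> per time \<open>l\<close> is the exponent \<open>- ln 2 / l\<close>\<close>
  define \<omega> where "\<omega> = \<beta> - ln 2 / l"
  have "lyap s (U s a x) \<le> 2 * C * exp (\<omega> * (s - a)) * lyap a x" if as: "0 \<le> a" "a \<le> s" for a s x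
  proof -
    define n where "n = nat \<lfloor>(s - a) / l\<rfloor>"
    have n: "real n \<le> (s - a) / l" "(s - a) / l \<le> n + 1"
      using as l(1) by (auto simp: n_def of_nat_nat) linarith+
    have "a + n * l \<le> s" using n(1) l(1) by (simp add: field_simps)
    from iterate[OF as(1) this] have 1: "g a x s \<le> C * (1/2) ^ n * lyap a x" .
    have "exp (- ln 2 * (real n + 1)) = exp (of_nat (Suc n) * - ln (2::real))" by (simp add: algebra_simps)
    also have "\<dots> = exp (- ln 2) ^ Suc n" by (rule exp_of_nat_mult)
    also have "exp (- ln 2) = (1/2 :: real)" by (simp add: exp_minus)
    finally have "(1/2) ^ n = 2 * exp (- ln 2 * (real n + 1))" by simp
    also have "\<dots> \<le> 2 * exp (- ln 2 * ((s - a) / l))"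
    proof -
      have "ln 2 * ((s - a) / l) \<le> ln 2 * (real n + 1)" using n(2) by (intro mult_left_mono) auto
      then have "- ln 2 * (real n + 1) \<le> - ln 2 * ((s - a) / l)" by linarith
      then show ?thesis by (simp only: exp_le_cancel_iff mult_le_cancel_left_pos zero_less_numeral)
    qed
    finally have 2: "(1/2) ^ n \<le> 2 * exp (- (ln 2 / l) * (s - a))" by simp
    have "lyap s (U s a x) = exp (\<beta> * (s - a)) * g a x s"
      unfolding g_def by (simp add: mult.assoc[symmetric] flip: exp_add)
    also have "\<dots> \<le> exp (\<beta> * (s - a)) * (C * (1/2) ^ n * lyap a x)" using 1 by simp
    also have "\<dots> \<le> exp (\<beta> * (s - a)) * (C * (2 * exp (- (ln 2 / l) * (s - a))) * lyap a x)"
      using 2 C lyap_nonneg[OF as(1)] by (intro mult_left_mono mult_right_mono) auto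
    also have "\<dots> = 2 * C * (exp (\<beta> * (s - a)) * exp (- (ln 2 / l) * (s - a))) * lyap a x" by simp
    also have "exp (\<beta> * (s - a)) * exp (- (ln 2 / l) * (s - a)) = exp (\<omega> * (s - a))"
      unfolding exp_add[symmetric] \<omega>_def by (simp add: algebra_simps)
    finally show ?thesis .
  qed
  then have "growth \<omega>" using C unfolding growth_def by (intro exI[of _ "2 * C"]) auto
  moreover have "\<omega> < \<beta>" using l(1) by (simp add: \<omega>_def)
  ultimately show ?thesis by blast
qed

end

section \<open>Truncated rescaled orbits as test functions\<close>

text \<open>A cut-off that is 1 on \<open>[a + 1, a + l - 1]\<close>. It is continuous and vanishes up to
  \<open>a\<close>, so that for \<open>a \<ge> 0\<close> it vanishes at \<open>0\<close>, as membership in the space requires.\<close>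

definition trapezoid :: "real \<Rightarrow> real \<Rightarrow> real \<Rightarrow> real" where
  "trapezoid a l \<tau> = max 0 (min 1 (min (\<tau> - a) (a + l - \<tau>)))"

lemma trapezoid_bounds: "0 \<le> trapezoid a l \<tau>" "trapezoid a l \<tau> \<le> 1"
  by (auto simp: trapezoid_def)

lemma trapezoid_outside: "\<tau> \<le> a \<or> a + l \<le> \<tau> \<Longrightarrow> trapezoid a l \<tau> = 0"
  by (auto simp: trapezoid_def)

lemma trapezoid_plateau: "a + 1 \<le> \<tau> \<Longrightarrow> \<tau> \<le> a + l - 1 \<Longrightarrow> trapezoid a l \<tau> = 1"
  by (auto simp: trapezoid_def)

lemma continuous_on_trapezoid: "continuous_on S p \<Longrightarrow> continuous_on S (\<lambda>x. trapezoid a l (p x))"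
  unfolding trapezoid_def by (intro continuous_intros)

context evolution_setting
begin

text \<open>The maximum only serves to give the formula a meaning for \<open>\<tau> < a\<close>, where the cut-off is zero.\<close>

definition orbit_bump :: "complex \<Rightarrow> real \<Rightarrow> real \<Rightarrow> 'a \<Rightarrow> real \<Rightarrow> 'a" where
  "orbit_bump \<mu> a l x \<tau> = (of_real (trapezoid a l \<tau>) * exp (- \<mu> * of_real (\<tau> - a))) *\<^sub>C U (max \<tau> a) a x"

lemma orbit_bump_lyap_le:
  assumes "0 \<le> a" "0 \<le> \<tau>" "0 \<le> l" "0 \<le> B"
    and B: "\<forall>\<tau>\<in>{a..a + l}. exp (- Re \<mu> * (\<tau> - a)) * lyap \<tau> (U \<tau> a x) \<le> B"
  shows "lyap \<tau> (orbit_bump \<mu> a l x \<tau>) \<le> B"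
proof (cases "\<tau> \<in> {a..a + l}")
  case True
  have "lyap \<tau> (orbit_bump \<mu> a l x \<tau>) = trapezoid a l \<tau> * (exp (- Re \<mu> * (\<tau> - a)) * lyap \<tau> (U \<tau> a x))"
    using True assms(2) trapezoid_bounds[of a l \<tau>]
    by (simp add: orbit_bump_def lyap_scaleC norm_mult)
  also have "\<dots> \<le> 1 * B"
    using True assms trapezoid_bounds by (intro mult_mono) (auto simp: lyap_nonneg)
  finally show ?thesis by simp
next
  case False
  then have "trapezoid a l \<tau> = 0" by (intro trapezoid_outside) auto
  then show ?thesis using assms by (simp add: orbit_bump_def scaleC.zero_left lyap_zero)
qed

lemma orbit_bump_in_V:
  assumes "0 \<le> a" "0 \<le> l"
  shows "orbit_bump \<mu> a l x \<in> V"
proof (rule V_intro)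
  show "continuous_on {0..} (orbit_bump \<mu> a l x)"
    unfolding orbit_bump_def
    by (intro scaleC.continuous_on continuous_intros continuous_on_trapezoid continuous_on_U) (use assms in auto)
  show "orbit_bump \<mu> a l x t = 0" if "t < 0" for t
    using trapezoid_outside[of t a l] that assms by (simp add: orbit_bump_def scaleC.zero_left)
  show "orbit_bump \<mu> a l x 0 = 0"
    using trapezoid_outside[of 0 a l] assms by (simp add: orbit_bump_def scaleC.zero_left)
  fix e :: real assume "e > 0"
  then have "lyap t (orbit_bump \<mu> a l x t) \<le> e" if "t \<ge> a + l" for t
    using trapezoid_outside[of t a l] that assms by (simp add: orbit_bump_def scaleC.zero_left lyap_zero)
  then show "\<exists>S. \<forall>t\<ge>S. t \<ge> 0 \<longrightarrow> lyap t (orbit_bump \<mu> a l x t) \<le> e" by blast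
qed

lemma N_orbit_bump_le:
  assumes "0 \<le> a" "0 \<le> l"
    and B: "\<forall>\<tau>\<in>{a..a + l}. exp (- Re \<mu> * (\<tau> - a)) * lyap \<tau> (U \<tau> a x) \<le> B"
  shows "N (orbit_bump \<mu> a l x) \<le> B"
proof (rule N_least)
  have "0 \<le> exp (- Re \<mu> * (a - a)) * lyap a (U a a x)" using assms by (simp add: lyap_nonneg)
  also have "\<dots> \<le> B" using assms by (intro bspec[OF B]) auto
  finally show "lyap s (orbit_bump \<mu> a l x s) \<le> B" if "0 \<le> s" for s
    using orbit_bump_lyap_le[OF assms(1) that assms(2) _ B] by simp
qed

text \<open>The shift by \<open>h\<close> and the factor \<open>exp (-\<mu> h)\<close> reproduce the rescaled orbit itself, and
  only the cut-off is moved. Hence a superposition of such shifts is the orbit times the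
  superposition of the cut-offs.\<close>

lemma T_orbit_bump:
  assumes "0 \<le> a" "a \<le> s" "0 \<le> h"
  shows "exp (- \<mu> * of_real h) *\<^sub>C T h (orbit_bump \<mu> a l x) s
       = of_real (trapezoid a l (s - h)) *\<^sub>C (exp (- \<mu> * of_real (s - a)) *\<^sub>C U s a x)"
proof (cases "a < s - h")
  case True
  have "exp (- \<mu> * of_real h) * exp (- \<mu> * of_real (s - h - a)) = exp (- \<mu> * of_real (s - a))"
    unfolding exp_add[symmetric] by (simp add: algebra_simps)
  then have *: "exp (- \<mu> * of_real h) * (t * exp (- \<mu> * of_real (s - h - a))) = t * exp (- \<mu> * of_real (s - a))" for t
    by (subst mult.left_commute) (simp only:)
  have "T h (orbit_bump \<mu> a l x) s
      = (of_real (trapezoid a l (s - h)) * exp (- \<mu> * of_real (s - h - a))) *\<^sub>C U s a x"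
    using True assms by (simp add: T_after orbit_bump_def U_scaleC U_comp)
  then show ?thesis by (simp only: scaleC_scaleC *)
next
  case False
  then have 0: "trapezoid a l (s - h) = 0" by (intro trapezoid_outside) auto
  then have "orbit_bump \<mu> a l x (s - h) = 0" by (simp add: orbit_bump_def scaleC.zero_left)
  then have "T h (orbit_bump \<mu> a l x) s = 0" using assms by (auto simp: evolution_semigroup_def U_zero)
  then show ?thesis using 0 by (simp add: scaleC.zero_left scaleC.zero_right)
qed
end

section \<open>Resolvent sets from explicit inverses\<close>

lemma resolvent_setI:
  assumes "\<And>u. u \<in> D \<Longrightarrow> (\<lambda>i. z *\<^sub>C u i - A u i) \<in> V"
    and "\<And>f. f \<in> V \<Longrightarrow> S f \<in> D" "\<And>f. f \<in> V \<Longrightarrow> (\<lambda>i. z *\<^sub>C S f i - A (S f) i) = f"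
    and "\<And>u. u \<in> D \<Longrightarrow> S (\<lambda>i. z *\<^sub>C u i - A u i) = u"
    and "\<And>f. f \<in> V \<Longrightarrow> N (S f) \<le> K * N f"
  shows "z \<in> resolvent_set V N D A"
proof -
  have "bij_betw (\<lambda>u i. z *\<^sub>C u i - A u i) D V"
    by (rule bij_betw_byWitness[where f'=S]) (use assms in auto)
  moreover have "\<forall>u\<in>D. N u \<le> K * N (\<lambda>i. z *\<^sub>C u i - A u i)"
    using assms by metis
  ultimately show ?thesis unfolding resolvent_set_def by blast
qed

text \<open>A left inverse that is given in advance must be the resolvent, which transfers the boundedness of
  the inverse to the explicit formula.\<close>

lemma resolvent_setE:
  assumes z: "z \<in> resolvent_set V N D A"
    and S: "\<And>u. u \<in> D \<Longrightarrow> S (\<lambda>i. z *\<^sub>C u i - A u i) = u"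
    and N: "\<And>f. f \<in> V \<Longrightarrow> 0 \<le> N f"
  obtains K where "K \<ge> 0" "\<And>f. f \<in> V \<Longrightarrow> S f \<in> D \<and> N (S f) \<le> K * N f"
proof -
  obtain K where bij: "bij_betw (\<lambda>u i. z *\<^sub>C u i - A u i) D V"
    and K: "\<forall>u\<in>D. N u \<le> K * N (\<lambda>i. z *\<^sub>C u i - A u i)"
    using z unfolding resolvent_set_def by blast
  have "S f \<in> D \<and> N (S f) \<le> max K 0 * N f" if f: "f \<in> V" for f
  proof -
    have "f \<in> (\<lambda>u i. z *\<^sub>C u i - A u i) ` D" using bij f by (simp add: bij_betw_def)
    then obtain u where u: "u \<in> D" "f = (\<lambda>i. z *\<^sub>C u i - A u i)" by blast
    then have "S f = u" using S by blast
    moreover have "N u \<le> K * N f" using K u by blast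
    moreover have "K * N f \<le> max K 0 * N f" using N[OF f] by (intro mult_right_mono) auto
    ultimately show ?thesis using u(1) by simp
  qed
  then show ?thesis by (intro that[of "max K 0"]) auto
qed

section \<open>The resolvent set of a semigroup operator\<close>

lemma mult_inverse_power_Suc: "z \<noteq> 0 \<Longrightarrow> z * inverse z ^ Suc k = inverse z ^ k" for z :: "'b::field"
  by (simp add: mult.assoc[symmetric])

lemma sum_power_le_geometric_tail:
  fixes q :: real
  assumes "0 \<le> q" "q < 1"
  shows "(\<Sum>k=j..<n. q ^ k) \<le> q ^ j / (1 - q)"
proof (cases "j \<le> n")
  case True
  have "(1 - q) * (\<Sum>k=j..<n. q ^ k) = q ^ j - q ^ n"
    using True
  proof (induction rule: dec_induct)
    case (step n)
    have "(1 - q) * (\<Sum>k=j..<Suc n. q ^ k) = (1 - q) * (\<Sum>k=j..<n. q ^ k) + (1 - q) * q ^ n"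
      using step.hyps by (simp add: distrib_left)
    then show ?case unfolding step.IH by (simp add: left_diff_distrib)
  qed simp
  also have "\<dots> \<le> q ^ j" using assms by simp
  finally show ?thesis using assms by (simp add: field_simps)
next
  case False then show ?thesis using assms by simp
qed

context evolution_setting
begin

text \<open>The Neumann series of \<open>(z - T t)\<^sup>-\<^sup>1\<close>, evaluated at \<open>s\<close>: the terms with \<open>k t \<ge> s\<close> vanish,
  so that a finite sum remains.\<close>

definition discrete_resolvent :: "real \<Rightarrow> complex \<Rightarrow> (real \<Rightarrow> 'a) \<Rightarrow> real \<Rightarrow> 'a" where
  "discrete_resolvent t z f s = (\<Sum>k<nat \<lceil>s / t\<rceil>. (inverse z ^ Suc k) *\<^sub>C T (real k * t) f s)"

text \<open>All further terms of the Neumann series vanish at \<open>s\<close>, so that a common number of terms can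
  be used for all \<open>s\<close> in a bounded interval.\<close>

lemma discrete_resolvent_eq:
  assumes "t > 0" "s \<le> real n * t"
  shows "discrete_resolvent t z f s = (\<Sum>k<n. (inverse z ^ Suc k) *\<^sub>C T (real k * t) f s)"
  unfolding discrete_resolvent_def
proof (rule sum.mono_neutral_left)
  have "s / t \<le> n" using assms by (simp add: field_simps)
  then have "nat \<lceil>s / t\<rceil> \<le> n" by linarith
  then show "{..<nat \<lceil>s / t\<rceil>} \<subseteq> {..<n}" by auto
  show "\<forall>k\<in>{..<n} - {..<nat \<lceil>s / t\<rceil>}. inverse z ^ Suc k *\<^sub>C T (real k * t) f s = 0"
  proof
    fix k assume "k \<in> {..<n} - {..<nat \<lceil>s / t\<rceil>}"
    then have "s / t \<le> real k" using real_nat_ceiling_ge[of "s / t"] by (simp add: not_less)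
    then have "s \<le> real k * t" using assms(1) by (simp add: field_simps)
    then show "inverse z ^ Suc k *\<^sub>C T (real k * t) f s = 0" by (simp add: T_before scaleC.zero_right)
  qed
qed simp

lemma exists_multiple_ge: assumes "t > 0" obtains n :: nat where "s \<le> real n * t"
proof -
  obtain n :: nat where "s / t < n" using reals_Archimedean2 by blast
  then show ?thesis using assms by (intro that[of n]) (simp add: field_simps)
qed

text \<open>Iterating \<open>u = (f + T t u) / z\<close> leaves the remainder \<open>T (n t) u / z\<^sup>n\<close>, which vanishes at
  \<open>s\<close> once \<open>n t \<ge> s\<close>. Hence \<open>z - T t\<close> is injective for every \<open>z \<noteq> 0\<close>, however small.\<close>

lemma discrete_resolvent_left_inverse:
  assumes t: "t > 0" and z: "z \<noteq> 0" and u: "u \<in> V"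
  shows "discrete_resolvent t z (\<lambda>i. z *\<^sub>C u i - T t u i) = u"
proof
  fix s
  let ?f = "\<lambda>i. z *\<^sub>C u i - T t u i"
  have telescope: "u s = (inverse z ^ n) *\<^sub>C T (real n * t) u s + (\<Sum>k<n. (inverse z ^ Suc k) *\<^sub>C T (real k * t) ?f s)" for n
  proof (induction n)
    case 0 then show ?case by (simp add: T_0[OF u])
  next
    case (Suc n)
    have "T (real n * t) ?f s = z *\<^sub>C T (real n * t) u s - T (Suc n * t) u s"
      using t by (simp add: T_diff T_scaleC T_T algebra_simps)
    then have "(inverse z ^ Suc n) *\<^sub>C T (real n * t) ?f s
        = (inverse z ^ n) *\<^sub>C T (real n * t) u s - (inverse z ^ Suc n) *\<^sub>C T (Suc n * t) u s"
      using mult_inverse_power_Suc[OF z, of n]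
      by (simp add: scaleC.diff_right scaleC_scaleC mult.commute[of _ z] del: power_Suc)
    then show ?case using Suc by simp
  qed
  obtain n :: nat where n: "s \<le> real n * t" using exists_multiple_ge[OF t] .
  then have "T (real n * t) u s = 0" by (simp add: T_before)
  then show "discrete_resolvent t z ?f s = u s"
    using telescope[of n] discrete_resolvent_eq[OF t n, of z ?f] by (simp add: scaleC.zero_right)
qed

lemma discrete_resolvent_right_inverse:
  assumes t: "t > 0" and z: "z \<noteq> 0" and f: "f \<in> V"
  shows "z *\<^sub>C discrete_resolvent t z f s - T t (discrete_resolvent t z f) s = f s"
proof -
  obtain n :: nat where n: "s \<le> real n * t" using exists_multiple_ge[OF t] .
  then have n': "s \<le> Suc n * t" "s - t \<le> real n * t" using t by (auto simp: algebra_simps)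
  have "T t (discrete_resolvent t z f) s = T t (\<lambda>i. \<Sum>k<n. (inverse z ^ Suc k) *\<^sub>C T (real k * t) f i) s"
    unfolding evolution_semigroup_def[of U t] discrete_resolvent_eq[OF t n'(2)] ..
  also have "\<dots> = (\<Sum>k<n. (inverse z ^ Suc k) *\<^sub>C T (Suc k * t) f s)"
    using t by (simp add: T_sum T_scaleC T_T algebra_simps)
  finally have 1: "T t (discrete_resolvent t z f) s = (\<Sum>k<n. (inverse z ^ Suc k) *\<^sub>C T (Suc k * t) f s)" .
  have "z *\<^sub>C discrete_resolvent t z f s = (\<Sum>k<Suc n. (inverse z ^ k) *\<^sub>C T (real k * t) f s)"
    unfolding discrete_resolvent_eq[OF t n'(1)] scaleC.sum_right
    by (simp only: scaleC_scaleC mult_inverse_power_Suc[OF z])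
  also have "\<dots> = f s + (\<Sum>k<n. (inverse z ^ Suc k) *\<^sub>C T (Suc k * t) f s)"
    unfolding sum.lessThan_Suc_shift using T_0[OF f] by simp
  finally show ?thesis using 1 by simp
qed

text \<open>The series from \<open>j\<close> on is dominated by the geometric series with ratio
  \<open>exp (\<omega> t) / |z|\<close>. Only values of \<open>f\<close> at distance at least \<open>j t\<close> to the left of \<open>s\<close>
  occur. The case \<open>j = 0\<close> bounds the norm; splitting at a large \<open>j\<close> shows that the result
  vanishes at infinity.\<close>

lemma discrete_resolvent_tail_le:
  assumes f: "f \<in> V" and t: "t > 0" and s: "0 \<le> s" and C: "0 \<le> C"
    and growth: "\<And>a s x. 0 \<le> a \<Longrightarrow> a \<le> s \<Longrightarrow> lyap s (U s a x) \<le> C * exp (\<omega> * (s - a)) * lyap a x"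
    and z: "exp (\<omega> * t) < cmod z"
    and B: "0 \<le> B" "\<And>k. j \<le> k \<Longrightarrow> k < n \<Longrightarrow> real k * t \<le> s \<Longrightarrow> lyap (s - real k * t) (f (s - real k * t)) \<le> B"
  shows "lyap s (\<Sum>k=j..<n. (inverse z ^ Suc k) *\<^sub>C T (real k * t) f s)
     \<le> C / (cmod z - exp (\<omega> * t)) * B * (exp (\<omega> * t) / cmod z) ^ j"
proof -
  define q where "q = exp (\<omega> * t) / cmod z"
  have z0: "cmod z > 0" using z by (smt (verit) exp_gt_zero)
  have q: "0 \<le> q" "q < 1" using z z0 by (auto simp: q_def field_simps)
  have "lyap s (\<Sum>k=j..<n. (inverse z ^ Suc k) *\<^sub>C T (real k * t) f s)
     \<le> (\<Sum>k=j..<n. lyap s ((inverse z ^ Suc k) *\<^sub>C T (real k * t) f s))"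
    by (rule lyap_sum[OF s]) simp
  also have "\<dots> \<le> (\<Sum>k=j..<n. C / cmod z * B * q ^ k)"
  proof (rule sum_mono)
    fix k assume k: "k \<in> {j..<n}"
    have "lyap s (T (real k * t) f s) \<le> C * exp (\<omega> * (real k * t)) * B"
      using k t s by (intro growth_lyap_T[OF f _ s C growth B(1)] B(2)) auto
    then have "cmod (inverse z ^ Suc k) * lyap s (T (real k * t) f s) \<le> cmod (inverse z ^ Suc k) * (C * exp (\<omega> * (real k * t)) * B)"
      by (intro mult_left_mono) auto
    also have "\<dots> = C / cmod z * B * q ^ k"
    proof -
      have "exp (\<omega> * (real k * t)) = exp (\<omega> * t) ^ k"
        by (simp add: exp_of_nat_mult[symmetric] mult_ac)
      then show ?thesis
        by (simp only: norm_power norm_inverse q_def) (simp add: divide_inverse power_mult_distrib mult_ac)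
    qed
    finally show "lyap s ((inverse z ^ Suc k) *\<^sub>C T (real k * t) f s) \<le> C / cmod z * B * q ^ k"
      by (simp only: lyap_scaleC[OF s])
  qed
  also have "\<dots> = C / cmod z * B * (\<Sum>k=j..<n. q ^ k)" by (simp add: sum_distrib_left)
  also have "\<dots> \<le> C / cmod z * B * (q ^ j / (1 - q))"
    using C B z0 sum_power_le_geometric_tail[OF q] by (intro mult_left_mono) auto
  also have "\<dots> = C / (cmod z * (1 - q)) * B * q ^ j" by simp
  also have "cmod z * (1 - q) = cmod z - exp (\<omega> * t)" using z0 by (simp add: q_def field_simps)
  finally show ?thesis unfolding q_def .
qed

lemma resolvent_of_semigroup_if_growth:
  assumes t: "t > 0" and g: "growth \<omega>" and z: "exp (\<omega> * t) < cmod z"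
  shows "z \<in> resolvent_set V N V (T t)"
proof -
  obtain C where C: "0 \<le> C" 
    and growth: "\<And>a s x. 0 \<le> a \<Longrightarrow> a \<le> s \<Longrightarrow> lyap s (U s a x) \<le> C * exp (\<omega> * (s - a)) * lyap a x"
    using g unfolding growth_def by blast
  have z0: "z \<noteq> 0" using z by (metis exp_gt_zero less_asym norm_zero)
  define D where "D = C / (cmod z - exp (\<omega> * t))"
  define q where "q = exp (\<omega> * t) / cmod z"
  have D: "D \<ge> 0" using C z by (simp add: D_def)
  have q: "0 \<le> q" "q < 1" using z z0 by (auto simp: q_def field_simps)
  note tail = discrete_resolvent_tail_le[OF _ t _ C growth z, folded D_def q_def]
  have in_V: "discrete_resolvent t z f \<in> V" if f: "f \<in> V" for f
  proof (rule V_intro)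
    show "continuous_on {0..} (discrete_resolvent t z f)"
    proof (rule continuous_on_halfline)
      fix b :: real assume "b > 0"
      obtain n :: nat where n: "b \<le> real n * t" using exists_multiple_ge[OF t] .
      have "continuous_on {0..b} (\<lambda>s. \<Sum>k<n. (inverse z ^ Suc k) *\<^sub>C T (real k * t) f s)"
        by (intro continuous_on_sum scaleC.continuous_on continuous_on_const T_continuous[OF f] continuous_on_id)
          (use t in auto)
      then show "continuous_on {0..b} (discrete_resolvent t z f)"
      proof (rule continuous_on_eq)
        fix s assume "s \<in> {0..b}"
        then have "s \<le> real n * t" using n by simp
        from discrete_resolvent_eq[OF t this]
        show "(\<Sum>k<n. (inverse z ^ Suc k) *\<^sub>C T (real k * t) f s) = discrete_resolvent t z f s" by (rule sym)
      qed
    qed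
    show "discrete_resolvent t z f 0 = 0" using discrete_resolvent_eq[OF t, of 0 0] by simp
    show "discrete_resolvent t z f s = 0" if "s < 0" for s
      using discrete_resolvent_eq[OF t, of s 0] that by simp
    fix e :: real assume e: "e > 0"
    \<comment> \<open>\<open>D + 1\<close> instead of \<open>D\<close> because \<open>D\<close> may be zero\<close>
    obtain S where S: "S > 0" "\<And>r. r \<ge> S \<Longrightarrow> lyap r (f r) \<le> e / 2 / (D + 1)"
      using V_tail[OF f, of "e / 2 / (D + 1)"] e D by auto
    have "(\<lambda>j. D * N f * q ^ j) \<longlonglongrightarrow> D * N f * 0"
      using q by (intro tendsto_mult tendsto_const LIMSEQ_power_zero) auto
    then have "\<forall>\<^sub>F j in sequentially. D * N f * q ^ j < e / 2"
      using e by (intro order_tendstoD(2)) auto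
    then obtain j where j: "D * N f * q ^ j < e / 2"
      unfolding eventually_sequentially by blast
    have "lyap s (discrete_resolvent t z f s) \<le> e" if s: "s \<ge> S + real j * t" "s \<ge> 0" for s
    proof -
      obtain n :: nat where n: "s \<le> real n * t" using exists_multiple_ge[OF t] .
      have "real j * t \<le> real n * t" using s n S(1) by linarith
      then have jn: "j \<le> n" using t by simp
      have "discrete_resolvent t z f s = (\<Sum>k=0..<j. (inverse z ^ Suc k) *\<^sub>C T (real k * t) f s)
            + (\<Sum>k=j..<n. (inverse z ^ Suc k) *\<^sub>C T (real k * t) f s)"
        unfolding discrete_resolvent_eq[OF t n] using jn
        by (simp add: sum.atLeastLessThan_concat lessThan_atLeast0)
      also have "lyap s \<dots> \<le> D * (e / 2 / (D + 1)) * q ^ 0 + D * N f * q ^ j"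
      proof (rule order_trans[OF lyap_add[OF s(2)] add_mono])
        show "lyap s (\<Sum>k=0..<j. (inverse z ^ Suc k) *\<^sub>C T (real k * t) f s) \<le> D * (e / 2 / (D + 1)) * q ^ 0"
        proof (rule tail[OF f s(2)])
          fix k :: nat assume "k < j"
          then have "real k * t \<le> real j * t" using t by (intro mult_right_mono) auto
          then show "lyap (s - real k * t) (f (s - real k * t)) \<le> e / 2 / (D + 1)" using s by (intro S(2)) linarith
        qed (use e D in auto)
        show "lyap s (\<Sum>k=j..<n. (inverse z ^ Suc k) *\<^sub>C T (real k * t) f s) \<le> D * N f * q ^ j"
          by (rule tail[OF f s(2)]) (use N_nonneg[OF f] lyap_le_N[OF f] in auto)
      qed
      also have "D * (e / 2 / (D + 1)) * q ^ 0 \<le> e / 2"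
        using D e by (simp add: field_simps)
      finally show ?thesis using j by linarith
    qed
    then show "\<exists>S. \<forall>s\<ge>S. s \<ge> 0 \<longrightarrow> lyap s (discrete_resolvent t z f s) \<le> e" by blast
  qed
  show ?thesis
  proof (rule resolvent_setI[where S="discrete_resolvent t z" and K=D])
    show "(\<lambda>i. z *\<^sub>C u i - T t u i) \<in> V" if "u \<in> V" for u
      using that t by (intro V_diff V_scaleC T_in_V) auto
    show "discrete_resolvent t z f \<in> V" if "f \<in> V" for f by (rule in_V[OF that])
    show "(\<lambda>i. z *\<^sub>C discrete_resolvent t z f i - T t (discrete_resolvent t z f) i) = f" if "f \<in> V" for f
      using discrete_resolvent_right_inverse[OF t z0 that] by (rule ext)
    show "discrete_resolvent t z (\<lambda>i. z *\<^sub>C u i - T t u i) = u" if "u \<in> V" for u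
      by (rule discrete_resolvent_left_inverse[OF t z0 that])
    show "N (discrete_resolvent t z f) \<le> D * N f" if f: "f \<in> V" for f
    proof (rule N_least)
      fix s :: real assume s: "0 \<le> s"
      obtain n :: nat where n: "s \<le> real n * t" using exists_multiple_ge[OF t] .
      have "lyap s (\<Sum>k=0..<n. (inverse z ^ Suc k) *\<^sub>C T (real k * t) f s) \<le> D * N f * q ^ 0"
        by (rule tail[OF f s]) (use N_nonneg[OF f] lyap_le_N[OF f] in auto)
      then show "lyap s (discrete_resolvent t z f s) \<le> D * N f"
        unfolding discrete_resolvent_eq[OF t n] by (simp add: lessThan_atLeast0)
    qed
  qed
qed

text \<open>The Neumann series maps a cut-off rescaled orbit to a multiple of that orbit. The multiple
  counts the shifts \<open>s - k t\<close> that fall into the support of the cut-off, at least \<open>m\<close> if the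
  plateau has length \<open>m t\<close>.\<close>

lemma growth_if_resolvent_of_semigroup:
  assumes t: "t > 0" and z0: "z \<noteq> 0" and z: "z \<in> resolvent_set V N V (T t)"
  shows "\<exists>\<omega>. growth \<omega> \<and> exp (\<omega> * t) < cmod z"
proof -
  obtain K where K: "K \<ge> 0" "\<And>f. f \<in> V \<Longrightarrow> discrete_resolvent t z f \<in> V \<and> N (discrete_resolvent t z f) \<le> K * N f"
    using resolvent_setE[where S="discrete_resolvent t z", OF z discrete_resolvent_left_inverse[OF t z0] N_nonneg] by blast
  \<comment> \<open>a logarithm turns the coefficients of the series into \<open>inverse z ^ k = exp (- \<mu> * (k * t))\<close>\<close>
  define \<mu> where "\<mu> = Ln z / of_real t"
  have Re_\<mu>: "Re \<mu> = ln (cmod z) / t" using z0 by (simp add: \<mu>_def)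
  have power: "inverse z ^ k = exp (- \<mu> * of_real (real k * t))" for k :: nat
  proof -
    have "exp (- \<mu> * of_real (real k * t)) = exp (of_nat k * (- Ln z))" using t by (simp add: \<mu>_def mult.commute)
    also have "\<dots> = inverse z ^ k" using z0 by (simp add: exp_of_nat_mult exp_minus power_inverse)
    finally show ?thesis by simp
  qed
  have "\<exists>\<omega><Re \<mu>. growth \<omega>"
  proof (rule growth_from_orbit_estimates)
    show "0 \<le> cmod z * K" using K(1) by simp
    fix m :: nat
    \<comment> \<open>the two ramps of the cut-off have length 1 each\<close>
    define l where "l = real m * t + 2"
    have l: "l > 0" using t by (simp add: l_def add_nonneg_pos)
    have "m * (exp (- Re \<mu> * (s - a)) * lyap s (U s a x)) \<le> (cmod z * K) * B"
      if a: "a \<ge> 0" and s: "s \<ge> a + l" and B: "\<forall>\<tau>\<in>{a..a + l}. exp (- Re \<mu> * (\<tau> - a)) * lyap \<tau> (U \<tau> a x) \<le> B" for a x s B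
    proof -
      let ?f = "orbit_bump \<mu> a l x"
      let ?y = "exp (- \<mu> * of_real (s - a)) *\<^sub>C U s a x"
      have s0: "0 \<le> s" "a \<le> s" using a s l by auto
      have f: "?f \<in> V" using orbit_bump_in_V a l by simp
      \<comment> \<open>the first shift that brings \<open>s\<close> back onto the plateau\<close>
      define k0 where "k0 = nat \<lceil>(s - (a + l - 1)) / t\<rceil>"
      have "(s - (a + l - 1)) / t > 0" using s t by (intro divide_pos_pos) auto
      then have "(s - (a + l - 1)) / t \<le> k0" "k0 < (s - (a + l - 1)) / t + 1"
        unfolding k0_def by linarith+
      then have k0: "s - (a + l - 1) \<le> real k0 * t" "real k0 * t < s - (a + l - 1) + t"
        using t by (auto simp: field_simps)
      obtain n' :: nat where n': "s \<le> real n' * t" using exists_multiple_ge[OF t] .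
      define n where "n = n' + (k0 + m)"
      have n: "s \<le> real n * t" "k0 + m \<le> n"
        using n' t by (auto simp: n_def distrib_right intro: add_increasing2)
      define \<Sigma> where "\<Sigma> = (\<Sum>k<n. trapezoid a l (s - real k * t))"
      have "real m = (\<Sum>k=k0..<k0 + m. 1)" by simp
      also have "\<dots> = (\<Sum>k=k0..<k0 + m. trapezoid a l (s - real k * t))"
      proof (rule sum.cong)
        fix k assume k: "k \<in> {k0..<k0 + m}"
        have 1: "real k0 * t \<le> real k * t" using k t by (intro mult_right_mono) auto
        have "real k \<le> real k0 + real m - 1" using k by auto
        then have "real k * t \<le> (real k0 + real m - 1) * t" using t by (intro mult_right_mono) auto
        also have "\<dots> = real k0 * t + real m * t - t" by (simp add: algebra_simps)
        finally have 2: "real k * t \<le> real k0 * t + real m * t - t" .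
        have "a + 1 \<le> s - real k * t" using 2 k0(2) unfolding l_def by linarith
        moreover have "s - real k * t \<le> a + l - 1" using 1 k0(1) by linarith
        ultimately show "1 = trapezoid a l (s - real k * t)" by (rule trapezoid_plateau[symmetric])
      qed simp
      also have "\<dots> \<le> \<Sigma>"
        unfolding \<Sigma>_def by (rule sum_mono2) (use n trapezoid_bounds in auto)
      finally have m: "real m \<le> \<Sigma>" .
      have "discrete_resolvent t z ?f s = (\<Sum>k<n. inverse z *\<^sub>C (of_real (trapezoid a l (s - real k * t)) *\<^sub>C ?y))"
        unfolding discrete_resolvent_eq[OF t n(1)]
      proof (rule sum.cong)
        fix k
        have "(inverse z ^ Suc k) *\<^sub>C T (real k * t) ?f s = inverse z *\<^sub>C (exp (- \<mu> * of_real (real k * t)) *\<^sub>C T (real k * t) ?f s)"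
          by (simp only: power[symmetric] scaleC_scaleC power_Suc)
        also have "\<dots> = inverse z *\<^sub>C (of_real (trapezoid a l (s - real k * t)) *\<^sub>C ?y)"
          using T_orbit_bump[OF a s0(2), of "real k * t" \<mu> l x] t by simp
        finally show "(inverse z ^ Suc k) *\<^sub>C T (real k * t) ?f s = inverse z *\<^sub>C (of_real (trapezoid a l (s - real k * t)) *\<^sub>C ?y)" .
      qed simp
      also have "\<dots> = inverse z *\<^sub>C (of_real \<Sigma> *\<^sub>C ?y)"
        unfolding \<Sigma>_def of_real_sum scaleC.sum_left scaleC.sum_right ..
      finally have *: "lyap s (discrete_resolvent t z ?f s) = inverse (cmod z) * (\<Sigma> * (exp (- Re \<mu> * (s - a)) * lyap s (U s a x)))"
        using m by (simp add: lyap_scaleC[OF s0(1)] norm_inverse)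
      have "\<Sigma> * (exp (- Re \<mu> * (s - a)) * lyap s (U s a x)) = cmod z * lyap s (discrete_resolvent t z ?f s)"
        unfolding * using z0 by simp
      also have "\<dots> \<le> cmod z * (K * B)"
      proof (rule mult_left_mono)
        have "lyap s (discrete_resolvent t z ?f s) \<le> N (discrete_resolvent t z ?f)"
          using lyap_le_N K(2)[OF f] s0(1) by blast
        also have "\<dots> \<le> K * N ?f" using K(2)[OF f] by blast
        also have "\<dots> \<le> K * B" using K(1) N_orbit_bump_le[OF a _ B] l by (intro mult_left_mono) auto
        finally show "lyap s (discrete_resolvent t z ?f s) \<le> K * B" .
      qed simp
      finally have "\<Sigma> * (exp (- Re \<mu> * (s - a)) * lyap s (U s a x)) \<le> cmod z * K * B" by simp
      moreover have "m * (exp (- Re \<mu> * (s - a)) * lyap s (U s a x)) \<le> \<Sigma> * (exp (- Re \<mu> * (s - a)) * lyap s (U s a x))"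
        using m lyap_nonneg[OF s0(1)] by (intro mult_right_mono) auto
      ultimately show ?thesis by linarith
    qed
    then show "\<exists>l>0. \<forall>a\<ge>0. \<forall>x. \<forall>s\<ge>a + l. \<forall>B.
          (\<forall>\<tau>\<in>{a..a + l}. exp (- Re \<mu> * (\<tau> - a)) * lyap \<tau> (U \<tau> a x) \<le> B) \<longrightarrow>
          m * (exp (- Re \<mu> * (s - a)) * lyap s (U s a x)) \<le> (cmod z * K) * B"
      using l by blast
  qed
  then obtain \<omega> where "\<omega> < Re \<mu>" "growth \<omega>" by blast
  moreover from this have "exp (\<omega> * t) < exp (ln (cmod z))" using t by (simp add: Re_\<mu> field_simps)
  ultimately show ?thesis using z0 by auto
qed

section \<open>The pointwise Laplace transform of the semigroup\<close>

text \<open>The Laplace transform of the semigroup, evaluated at \<open>s\<close>. The integrand vanishes for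
  \<open>r \<ge> s\<close>, and for negative \<open>s\<close> the interval is empty and the integral is zero.\<close>

definition laplace_resolvent :: "complex \<Rightarrow> (real \<Rightarrow> 'a) \<Rightarrow> real \<Rightarrow> 'a" where
  "laplace_resolvent \<mu> f s = integral {0..s} (\<lambda>r. exp (- \<mu> * of_real r) *\<^sub>C T r f s)"

lemma continuous_on_laplace_integrand:
  assumes f: "f \<in> V" and "0 \<le> a" "0 \<le> s"
  shows "continuous_on {a..b} (\<lambda>r. exp (- \<mu> * of_real r) *\<^sub>C T r f s)"
  by (intro scaleC.continuous_on T_continuous[OF f] continuous_intros) (use assms in auto)

text \<open>Enlarging the interval of integration changes nothing, so that a common interval can be used for
  all \<open>s\<close> in a bounded set.\<close>

lemma laplace_resolvent_eq:
  assumes f: "f \<in> V" and "0 \<le> s" "s \<le> b"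
  shows "laplace_resolvent \<mu> f s = integral {0..b} (\<lambda>r. exp (- \<mu> * of_real r) *\<^sub>C T r f s)"
proof -
  let ?F = "\<lambda>r. exp (- \<mu> * of_real r) *\<^sub>C T r f s"
  have "integral {s..b} ?F = integral {s..b} (\<lambda>_. 0)"
    by (rule integral_cong) (simp add: T_before scaleC.zero_right)
  then have "integral {s..b} ?F = 0" by simp
  moreover have "integral {0..s} ?F + integral {s..b} ?F = integral {0..b} ?F"
    by (intro Henstock_Kurzweil_Integration.integral_combine integrable_continuous_real continuous_on_laplace_integrand f) (use assms in auto)
  ultimately show ?thesis by (simp add: laplace_resolvent_def)
qed

lemma integral_exp_tail_le:
  fixes \<delta> :: real
  assumes "\<delta> > 0" "a \<le> b"
  shows "integral {a..b} (\<lambda>r. exp (- \<delta> * r)) \<le> exp (- \<delta> * a) / \<delta>"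
proof -
  have "((\<lambda>r. exp (- \<delta> * r)) has_integral (- exp (- \<delta> * b) / \<delta>) - (- exp (- \<delta> * a) / \<delta>)) {a..b}"
  proof (rule fundamental_theorem_of_calculus[OF assms(2)])
    fix r show "((\<lambda>r. - exp (- \<delta> * r) / \<delta>) has_vector_derivative exp (- \<delta> * r)) (at r within {a..b})"
      unfolding has_real_derivative_iff_has_vector_derivative[symmetric]
      by (auto intro!: derivative_eq_intros simp: assms(1) less_imp_neq[OF assms(1), symmetric])
  qed
  from integral_unique[OF this] show ?thesis using assms(1) by simp
qed

text \<open>The continuous counterpart of \<open>discrete_resolvent_tail_le\<close>: the part of the integral after
  \<open>a\<close> is dominated by \<open>\<integral> exp (-(Re \<mu> - \<omega>) r) dr\<close>.\<close>

lemma laplace_tail_le: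
  assumes f: "f \<in> V" and s: "0 \<le> s" and C: "0 \<le> C" and ab: "0 \<le> a" "a \<le> b"
    and growth: "\<And>a s x. 0 \<le> a \<Longrightarrow> a \<le> s \<Longrightarrow> lyap s (U s a x) \<le> C * exp (\<omega> * (s - a)) * lyap a x"
    and \<omega>: "\<omega> < Re \<mu>"
    and B: "0 \<le> B" "\<And>r. a \<le> r \<Longrightarrow> r \<le> b \<Longrightarrow> r \<le> s \<Longrightarrow> lyap (s - r) (f (s - r)) \<le> B"
  shows "lyap s (integral {a..b} (\<lambda>r. exp (- \<mu> * of_real r) *\<^sub>C T r f s))
     \<le> C / (Re \<mu> - \<omega>) * B * exp (- (Re \<mu> - \<omega>) * a)"
proof -
  let ?\<delta> = "Re \<mu> - \<omega>"
  have "lyap s (integral {a..b} (\<lambda>r. exp (- \<mu> * of_real r) *\<^sub>C T r f s))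
      \<le> integral {a..b} (\<lambda>r. C * B * exp (- ?\<delta> * r))"
  proof (rule lyap_integral[OF s])
    show "continuous_on {a..b} (\<lambda>r. exp (- \<mu> * of_real r) *\<^sub>C T r f s)"
      by (rule continuous_on_laplace_integrand[OF f ab(1) s])
    show "(\<lambda>r. C * B * exp (- ?\<delta> * r)) integrable_on {a..b}"
      by (intro integrable_continuous_real continuous_intros)
    fix r assume r: "r \<in> {a..b}"
    have "lyap s (T r f s) \<le> C * exp (\<omega> * r) * B"
      using r ab by (intro growth_lyap_T[OF f _ s C growth B(1)] B(2)) auto
    then have "exp (- Re \<mu> * r) * lyap s (T r f s) \<le> exp (- Re \<mu> * r) * (C * exp (\<omega> * r) * B)"
      by (rule mult_left_mono) simp
    also have "\<dots> = C * B * (exp (- Re \<mu> * r) * exp (\<omega> * r))" by (simp only: mult_ac)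
    also have "exp (- Re \<mu> * r) * exp (\<omega> * r) = exp (- ?\<delta> * r)"
      unfolding exp_add[symmetric] by (simp add: algebra_simps)
    finally show "lyap s (exp (- \<mu> * of_real r) *\<^sub>C T r f s) \<le> C * B * exp (- ?\<delta> * r)"
      by (simp add: lyap_scaleC[OF s])
  qed
  also have "\<dots> = C * B * integral {a..b} (\<lambda>r. exp (- ?\<delta> * r))" by (rule integral_mult_right)
  also have "\<dots> \<le> C * B * (exp (- ?\<delta> * a) / ?\<delta>)"
    using C B(1) \<omega> integral_exp_tail_le[OF _ ab(2), of ?\<delta>] by (intro mult_left_mono) auto
  finally show ?thesis by simp
qed

lemma laplace_resolvent_in_V:
  assumes f: "f \<in> V" and C: "0 \<le> C"
    and growth: "\<And>a s x. 0 \<le> a \<Longrightarrow> a \<le> s \<Longrightarrow> lyap s (U s a x) \<le> C * exp (\<omega> * (s - a)) * lyap a x"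
    and \<omega>: "\<omega> < Re \<mu>"
  shows "laplace_resolvent \<mu> f \<in> V"
proof (rule V_intro)
  let ?F = "\<lambda>s r. exp (- \<mu> * of_real r) *\<^sub>C T r f s"
  define \<delta> where "\<delta> = Re \<mu> - \<omega>"
  define D where "D = C / \<delta>"
  have \<delta>: "\<delta> > 0" and D: "D \<ge> 0" using \<omega> C by (auto simp: \<delta>_def D_def)
  note tail = laplace_tail_le[OF f _ C _ _ growth \<omega>, folded \<delta>_def, folded D_def]
  show "continuous_on {0..} (laplace_resolvent \<mu> f)"
  proof (rule continuous_on_halfline)
    fix b :: real assume "b > 0"
    have "continuous_on ({0..b} \<times> cbox 0 b) (\<lambda>(s, r). ?F s r)"
      unfolding split_beta
      by (intro scaleC.continuous_on T_continuous[OF f] continuous_intros) auto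
    then have "continuous_on {0..b} (\<lambda>s. integral (cbox 0 b) (?F s))"
      by (rule integral_continuous_on_param)
    then show "continuous_on {0..b} (laplace_resolvent \<mu> f)"
      by (rule continuous_on_eq) (use laplace_resolvent_eq[OF f] in auto)
  qed
  show "laplace_resolvent \<mu> f 0 = 0" by (simp add: laplace_resolvent_def)
  show "laplace_resolvent \<mu> f s = 0" if "s < 0" for s using that by (simp add: laplace_resolvent_def)
  fix e :: real assume e: "e > 0"
  obtain S where S: "S > 0" "\<And>r. r \<ge> S \<Longrightarrow> lyap r (f r) \<le> e / 2 / (D + 1)"
    using V_tail[OF f, of "e / 2 / (D + 1)"] e D by auto
  have "((\<lambda>x. exp (- \<delta> * x)) \<longlongrightarrow> 0) at_top" using \<delta> by real_asymp
  then have "((\<lambda>x. D * N f * exp (- \<delta> * x)) \<longlongrightarrow> 0) at_top" by (rule tendsto_mult_right_zero)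
  then have "\<forall>\<^sub>F x in at_top. D * N f * exp (- \<delta> * x) < e / 2"
    using e by (intro order_tendstoD(2)) auto
  then obtain x0 where x0: "\<And>x. x \<ge> x0 \<Longrightarrow> D * N f * exp (- \<delta> * x) < e / 2"
    unfolding eventually_at_top_linorder by blast
  have "lyap s (laplace_resolvent \<mu> f s) \<le> e" if s: "s \<ge> S + max x0 0" "s \<ge> 0" for s
  proof -
    have sS: "0 \<le> s - S" "s - S \<le> s" using s S(1) by auto
    have "laplace_resolvent \<mu> f s = integral {0..s - S} (?F s) + integral {s - S..s} (?F s)"
      unfolding laplace_resolvent_def
      by (rule Henstock_Kurzweil_Integration.integral_combine[symmetric, OF sS integrable_continuous_real
            [OF continuous_on_laplace_integrand[OF f order.refl s(2)]]])
    also have "lyap s \<dots> \<le> D * (e / 2 / (D + 1)) * exp (- \<delta> * 0) + D * N f * exp (- \<delta> * (s - S))"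
      by (rule order_trans[OF lyap_add[OF s(2)] add_mono[OF tail tail]])
        (use sS S e D N_nonneg[OF f] lyap_le_N[OF f] s in auto)
    also have "D * (e / 2 / (D + 1)) * exp (- \<delta> * 0) \<le> e / 2"
      using D e by (simp add: field_simps)
    finally have "lyap s (laplace_resolvent \<mu> f s) \<le> e / 2 + D * N f * exp (- \<delta> * (s - S))" by simp
    moreover have "x0 \<le> s - S" using s(1) by simp
    ultimately show ?thesis using x0[of "s - S"] by linarith
  qed
  then show "\<exists>S. \<forall>s\<ge>S. s \<ge> 0 \<longrightarrow> lyap s (laplace_resolvent \<mu> f s) \<le> e" by blast
qed

lemma N_laplace_resolvent_le:
  assumes f: "f \<in> V" and C: "0 \<le> C"
    and growth: "\<And>a s x. 0 \<le> a \<Longrightarrow> a \<le> s \<Longrightarrow> lyap s (U s a x) \<le> C * exp (\<omega> * (s - a)) * lyap a x"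
    and \<omega>: "\<omega> < Re \<mu>"
  shows "N (laplace_resolvent \<mu> f) \<le> C / (Re \<mu> - \<omega>) * N f"
proof (rule N_least)
  fix s :: real assume s: "0 \<le> s"
  have "lyap s (laplace_resolvent \<mu> f s) \<le> C / (Re \<mu> - \<omega>) * N f * exp (- (Re \<mu> - \<omega>) * 0)"
    unfolding laplace_resolvent_def
    by (rule laplace_tail_le[OF f s C _ _ growth \<omega>]) (use s N_nonneg[OF f] lyap_le_N[OF f] in auto)
  then show "lyap s (laplace_resolvent \<mu> f s) \<le> C / (Re \<mu> - \<omega>) * N f" by simp
qed

section \<open>The generator and its resolvent set\<close>

abbreviation "gen_value \<equiv> is_generator_value V N T"
abbreviation "gen_dom \<equiv> generator_domain V N T"
abbreviation "gen \<equiv> generator V N T"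

text \<open>Convergence in the norm of the space gives difference quotients that converge uniformly in the
  fibre, measured in Lyapunov norms.\<close>

lemma gen_value_difference_quotient_le:
  assumes u: "u \<in> V" and v: "gen_value u v" and e: "e > 0"
  obtains d where "d > 0"
    "\<And>h s. 0 < h \<Longrightarrow> h < d \<Longrightarrow> 0 \<le> s \<Longrightarrow> lyap s (T h u s - u s - h *\<^sub>R v s) \<le> e * h"
proof -
  let ?E = "\<lambda>h i. (1 / h) *\<^sub>R (T h u i - u i) - v i"
  have vV: "v \<in> V" and lim: "((\<lambda>h. N (?E h)) \<longlongrightarrow> 0) (at_right 0)"
    using v by (auto simp: is_generator_value_def)
  have "\<forall>\<^sub>F h in at_right 0. N (?E h) < e" using lim e by (rule order_tendstoD(2))
  then obtain d where d: "d > 0" "\<And>h. 0 < h \<Longrightarrow> h < d \<Longrightarrow> N (?E h) < e"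
    unfolding eventually_at_right_field by auto
  have "lyap s (T h u s - u s - h *\<^sub>R v s) \<le> e * h" if h: "0 < h" "h < d" and s: "0 \<le> s" for h s
  proof -
    have "?E h \<in> V" using u vV h by (intro V_diff V_scaleR T_in_V) auto
    then have "lyap s (?E h s) \<le> e" using lyap_le_N[OF _ s] d(2)[OF h] by fastforce
    moreover have "T h u s - u s - h *\<^sub>R v s = h *\<^sub>R ?E h s"
      using h by (simp add: scaleR_diff_right)
    ultimately show ?thesis using h lyap_scaleR[OF s, of h "?E h s"] by (simp add: mult.commute)
  qed
  then show ?thesis using d(1) that by blast
qed

text \<open>For fixed \<open>s\<close> the function \<open>r \<mapsto> exp (-\<mu> r) T r u s\<close> runs from \<open>u s\<close> to \<open>0\<close>
  on \<open>[0, s]\<close>, and its derivative is \<open>-exp (-\<mu> r) T r (\<mu> u - v) s\<close>; the fundamental theorem of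
  calculus does the rest. Hence \<open>\<mu> - G\<close> is injective for every
  \<open>\<mu>\<close>, and only surjectivity and boundedness can fail.\<close>

lemma laplace_resolvent_of_gen_value:
  assumes u: "u \<in> V" and v: "gen_value u v"
  shows "laplace_resolvent \<mu> (\<lambda>i. \<mu> *\<^sub>C u i - v i) = u"
proof
  fix s
  let ?f = "\<lambda>i. \<mu> *\<^sub>C u i - v i"
  have vV: "v \<in> V" using v by (simp add: is_generator_value_def)
  show "laplace_resolvent \<mu> ?f s = u s"
  proof (cases "0 \<le> s")
    case False
    then show ?thesis using V_neg[OF u, of s] by (simp add: laplace_resolvent_def)
  next
    case s: True
    \<comment> \<open>\<open>T r\<close> enlarges the errors by at most \<open>exp (\<bar>\<alpha>\<bar> * s)\<close>, uniformly in \<open>r\<close>\<close>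
    have deriv: "((\<lambda>r. T r u s) has_vector_derivative T r v s) (at r within {0..s})" if "r \<in> {0..s}" for r
    proof (rule has_vector_derivative_from_uniform_forward_differences[OF _ _ that])
      show "continuous_on {0..s} (\<lambda>r. T r v s)"
        by (intro T_continuous[OF vV] continuous_intros) (use s in auto)
      fix e :: real assume e: "e > 0"
      let ?c = "exp (\<bar>\<alpha>\<bar> * s)"
      obtain d where d: "d > 0"
        "\<And>h s. 0 < h \<Longrightarrow> h < d \<Longrightarrow> 0 \<le> s \<Longrightarrow> lyap s (T h u s - u s - h *\<^sub>R v s) \<le> e / ?c * h"
        using gen_value_difference_quotient_le[OF u v, of "e / ?c"] e by auto
      have "norm (T (r + h) u s - T r u s - h *\<^sub>R T r v s) \<le> e * h"
        if h: "0 < h" "h < d" and r: "0 \<le> r" "r + h \<le> s" for h r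
      proof -
        let ?E = "\<lambda>i. T h u i - u i - h *\<^sub>R v i"
        have E: "?E \<in> V" using u vV h by (intro V_diff V_scaleR T_in_V) auto
        have "norm (T (r + h) u s - T r u s - h *\<^sub>R T r v s) = norm (T r ?E s)"
          using r h by (simp add: T_diff T_scaleR T_T)
        also have "\<dots> \<le> lyap s (T r ?E s)" by (rule norm_le_lyap[OF s])
        also have "\<dots> \<le> exp (\<alpha> * r) * lyap (max (s - r) 0) (?E (max (s - r) 0))"
          by (rule lyap_T[OF E r(1) s])
        also have "\<dots> \<le> ?c * (e / ?c * h)"
        proof (intro mult_mono d(2) h)
          have "\<alpha> * r \<le> \<bar>\<alpha>\<bar> * s" using r h by (intro mult_mono) auto
          then show "exp (\<alpha> * r) \<le> ?c" by simp
        qed (auto simp: lyap_nonneg)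
        finally show ?thesis by simp
      qed
      then show "\<exists>d>0. \<forall>h r. 0 < h \<and> h < d \<and> 0 \<le> r \<and> r + h \<le> s \<longrightarrow>
          norm (T (r + h) u s - T r u s - h *\<^sub>R T r v s) \<le> e * h" using d(1) by blast
    qed
    \<comment> \<open>the derivative of the semigroup orbit is combined with that of the scalar factor\<close>
    let ?w = "\<lambda>r. exp (- \<mu> * of_real r) *\<^sub>C T r u s"
    have "(?w has_vector_derivative - (exp (- \<mu> * of_real r) *\<^sub>C T r ?f s)) (at r within {0..s})" if r: "r \<in> {0..s}" for r
    proof -
      have "((\<lambda>r. exp (- \<mu> * of_real r)) has_vector_derivative - \<mu> * exp (- \<mu> * of_real r)) (at r within {0..s})"
        by (rule has_vector_derivative_real_field) (auto intro!: derivative_eq_intros)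
      from scaleC.has_vector_derivative[OF this deriv[OF r]]
      have "(?w has_vector_derivative exp (- \<mu> * of_real r) *\<^sub>C T r v s + (- \<mu> * exp (- \<mu> * of_real r)) *\<^sub>C T r u s) (at r within {0..s})" .
      moreover have "exp (- \<mu> * of_real r) *\<^sub>C T r v s + (- \<mu> * exp (- \<mu> * of_real r)) *\<^sub>C T r u s
          = - (exp (- \<mu> * of_real r) *\<^sub>C T r ?f s)"
        using r by (simp add: T_diff T_scaleC scaleC.diff_right scaleC_scaleC scaleC.minus_left mult.commute)
      ultimately show ?thesis by simp
    qed
    from fundamental_theorem_of_calculus[OF s this]
    have "((\<lambda>r. - (exp (- \<mu> * of_real r) *\<^sub>C T r ?f s)) has_integral ?w s - ?w 0) {0..s}" by blast
    moreover have "?w s = 0" by (simp add: T_before scaleC.zero_right)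
    moreover have "?w 0 = u s" by (simp add: T_0[OF u])
    ultimately have "((\<lambda>r. - (exp (- \<mu> * of_real r) *\<^sub>C T r ?f s)) has_integral - u s) {0..s}" by simp
    from has_integral_neg[OF this] show ?thesis
      unfolding laplace_resolvent_def by (simp add: integral_unique)
  qed
qed

lemma gen_value_unique:
  assumes u: "u \<in> V" and "gen_value u v" "gen_value u w"
  shows "v = w"
proof
  fix s
  have V: "v \<in> V" "w \<in> V" using assms by (auto simp: is_generator_value_def)
  show "v s = w s"
  proof (cases "0 \<le> s")
    case False
    then show ?thesis using V by (simp add: V_neg)
  next
    case s: True
    have "norm (v s - w s) \<le> 0"
    proof (rule field_le_epsilon)
      fix e :: real assume e: "e > 0"
      obtain d where d: "d > 0" "\<And>h s. 0 < h \<Longrightarrow> h < d \<Longrightarrow> 0 \<le> s \<Longrightarrow> lyap s (T h u s - u s - h *\<^sub>R v s) \<le> e / 2 * h"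
        using gen_value_difference_quotient_le[OF u assms(2), of "e / 2"] e by auto
      obtain d' where d': "d' > 0" "\<And>h s. 0 < h \<Longrightarrow> h < d' \<Longrightarrow> 0 \<le> s \<Longrightarrow> lyap s (T h u s - u s - h *\<^sub>R w s) \<le> e / 2 * h"
        using gen_value_difference_quotient_le[OF u assms(3), of "e / 2"] e by auto
      define h where "h = min d d' / 2"
      have h: "0 < h" "h < d" "h < d'" using d(1) d'(1) by (auto simp: h_def min_def)
      have "h *\<^sub>R (v s - w s) = (T h u s - u s - h *\<^sub>R w s) - (T h u s - u s - h *\<^sub>R v s)"
        by (simp add: scaleR_diff_right)
      then have "lyap s (h *\<^sub>R (v s - w s)) \<le> e / 2 * h + e / 2 * h"
        using lyap_diff[OF s] d(2)[OF h(1,2) s] d'(2)[OF h(1,3) s] by (smt (verit))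
      then have "h * lyap s (v s - w s) \<le> h * e" using h(1) by (simp add: lyap_scaleR[OF s] mult.commute)
      then have "lyap s (v s - w s) \<le> e" using h(1) by simp
      then show "norm (v s - w s) \<le> 0 + e" using norm_le_lyap[OF s, of "v s - w s"] by simp
    qed
    then show ?thesis by simp
  qed
qed

lemma gen_eq: "u \<in> V \<Longrightarrow> gen_value u v \<Longrightarrow> gen u = v"
  unfolding generator_def using gen_value_unique by blast

lemma gen_value_gen: "u \<in> gen_dom \<Longrightarrow> u \<in> V \<and> gen_value u (gen u)"
  unfolding generator_domain_def using gen_eq by auto

text \<open>Applying the semigroup shifts the variable of integration, and the integral over the initial
  interval \<open>[0, h]\<close> is lost.\<close>

lemma T_laplace_resolvent:
  assumes f: "f \<in> V" and h: "0 \<le> h" and s: "0 \<le> s"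
  shows "T h (laplace_resolvent \<mu> f) s = exp (\<mu> * of_real h) *\<^sub>C
     (laplace_resolvent \<mu> f s - integral {0..h} (\<lambda>r. exp (- \<mu> * of_real r) *\<^sub>C T r f s))"
proof (cases "h < s")
  case False
  then show ?thesis using laplace_resolvent_eq[OF f s, of h]
    by (simp add: T_before scaleC.zero_right)
next
  case True
  let ?F = "\<lambda>r. exp (- \<mu> * of_real r) *\<^sub>C T r f s"
  have cont: "continuous_on {a..b} (\<lambda>r. exp (- \<mu> * of_real r) *\<^sub>C T r f s')" if "0 \<le> a" "0 \<le> s'" for a b s'
    using continuous_on_laplace_integrand[OF f that] .
  have "T h (laplace_resolvent \<mu> f) s = U s (s - h) (integral {0..s - h} (\<lambda>r. exp (- \<mu> * of_real r) *\<^sub>C T r f (s - h)))"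
    using True by (simp add: T_after laplace_resolvent_def)
  also have "\<dots> = integral {0..s - h} (\<lambda>r. U s (s - h) (exp (- \<mu> * of_real r) *\<^sub>C T r f (s - h)))"
    using integral_linear[OF integrable_continuous_real[OF cont] U_bounded_linear[of "s - h" s], of 0 "s - h" "s - h"] True h
    unfolding o_def by simp
  also have "\<dots> = integral {0..s - h} (\<lambda>r. exp (\<mu> * of_real h) *\<^sub>C ?F (r + h))"
  proof (rule integral_cong)
    fix r assume r: "r \<in> {0..s - h}"
    have "U s (s - h) (T r f (s - h)) = T h (T r f) s" using True by (simp add: T_after)
    also have "\<dots> = T (r + h) f s" using r h by (simp add: T_T add.commute)
    finally have "U s (s - h) (T r f (s - h)) = T (r + h) f s" .
    moreover have "exp (- \<mu> * of_real r) = exp (\<mu> * of_real h) * exp (- \<mu> * of_real (r + h))"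
      unfolding exp_add[symmetric] by (simp add: algebra_simps)
    ultimately show "U s (s - h) (exp (- \<mu> * of_real r) *\<^sub>C T r f (s - h)) = exp (\<mu> * of_real h) *\<^sub>C ?F (r + h)"
      using True h by (simp only: scaleC_scaleC) (simp add: U_scaleC)
  qed
  also have "\<dots> = integral {h - h..s - h} (\<lambda>r. exp (\<mu> * of_real h) *\<^sub>C ?F (r + h))" by simp
  also have "\<dots> = integral {h..s} (\<lambda>r. exp (\<mu> * of_real h) *\<^sub>C ?F r)"
    by (rule integral_shift_real_ivl)
  also have "\<dots> = exp (\<mu> * of_real h) *\<^sub>C integral {h..s} ?F"
    using integral_linear[OF integrable_continuous_real[OF cont[OF h s]] scaleC.bounded_linear_right]
    unfolding o_def .
  also have "integral {h..s} ?F = laplace_resolvent \<mu> f s - integral {0..h} ?F"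
  proof -
    have "integral {0..h} ?F + integral {h..s} ?F = integral {0..s} ?F"
      using True h by (intro Henstock_Kurzweil_Integration.integral_combine integrable_continuous_real cont s) auto
    then show ?thesis by (simp add: laplace_resolvent_def algebra_simps)
  qed
  finally show ?thesis .
qed
end

lemma norm_exp_minus_one_le: "cmod (exp z - 1) \<le> exp (cmod z) * cmod z"
  using Taylor_exp_field[of z 0] by simp

lemma tendsto_exp_difference_quotient:
  "((\<lambda>h. (exp (\<mu> * complex_of_real h) - 1) / of_real h) \<longlongrightarrow> \<mu>) (at_right 0)"
proof -
  have "((\<lambda>z. exp (\<mu> * z)) has_field_derivative \<mu>) (at 0)"
    by (auto intro!: derivative_eq_intros)
  then have "((\<lambda>z. (exp (\<mu> * z) - 1) / z) \<longlongrightarrow> \<mu>) (at 0)" by (simp add: DERIV_def)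
  moreover have "filterlim complex_of_real (at 0) (at_right 0)"
    unfolding filterlim_at
    by (auto intro!: tendsto_eq_intros eventually_at_right_less[THEN eventually_mono])
  ultimately show ?thesis by (rule filterlim_compose)
qed

lemma Re_Ln_scaled_le_iff:
  assumes "t > 0" "z \<noteq> 0"
  shows "Re (Ln z / of_real t) \<le> \<omega> \<longleftrightarrow> cmod z \<le> exp (\<omega> * t)"
proof -
  have "Re (Ln z / of_real t) \<le> \<omega> \<longleftrightarrow> ln (cmod z) \<le> \<omega> * t"
  proof -
    have "Re (Ln z / of_real t) = ln (cmod z) / t" using assms by simp
    then show ?thesis by (simp only: pos_divide_le_eq[OF assms(1)])
  qed
  also have "\<dots> \<longleftrightarrow> exp (ln (cmod z)) \<le> exp (\<omega> * t)" by simp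
  also have "exp (ln (cmod z)) = cmod z" using assms by simp
  finally show ?thesis .
qed

lemma exp_image_half_plane:
  assumes "t > 0"
  shows "(\<lambda>z. exp (complex_of_real t * z)) ` {z. Re z \<le> \<omega>} = {z. z \<noteq> 0 \<and> cmod z \<le> exp (\<omega> * t)}"
proof (intro equalityI subsetI)
  fix z assume "z \<in> {z. z \<noteq> 0 \<and> cmod z \<le> exp (\<omega> * t)}"
  then have z: "z \<noteq> 0" "cmod z \<le> exp (\<omega> * t)" by auto
  then have "Ln z / of_real t \<in> {z. Re z \<le> \<omega>}" using Re_Ln_scaled_le_iff[OF assms] by blast
  moreover have "z = exp (of_real t * (Ln z / of_real t))" using assms z(1) by simp
  ultimately show "z \<in> (\<lambda>z. exp (complex_of_real t * z)) ` {z. Re z \<le> \<omega>}" by blast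
qed (use assms in \<open>auto simp: mult.commute\<close>)

context evolution_setting
begin

text \<open>The defect in the resolvent equation is split into a scalar defect that tends to \<open>0\<close> and a mean
  over \<open>[0, h]\<close> that tends to \<open>0\<close> by strong continuity.\<close>

lemma difference_quotient_of_laplace_resolvent:
  assumes f: "f \<in> V" and h: "0 < h" and s: "0 \<le> s"
  shows "(1 / h) *\<^sub>R (T h (laplace_resolvent \<mu> f) s - laplace_resolvent \<mu> f s)
        - (\<mu> *\<^sub>C laplace_resolvent \<mu> f s - f s)
     = ((exp (\<mu> * of_real h) - 1) / of_real h - \<mu>) *\<^sub>C laplace_resolvent \<mu> f s
        - (1 / h) *\<^sub>R integral {0..h} (\<lambda>r. exp (\<mu> * of_real (h - r)) *\<^sub>C T r f s - f s)"
proof -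
  let ?F = "\<lambda>r. exp (- \<mu> * of_real r) *\<^sub>C T r f s"
  let ?e = "exp (\<mu> * complex_of_real h)" and ?u = "laplace_resolvent \<mu> f s" and ?I = "integral {0..h} ?F"
  have F: "continuous_on {0..h} ?F"
    by (rule continuous_on_laplace_integrand[OF f order.refl s])
  have "integral {0..h} (\<lambda>r. exp (\<mu> * of_real (h - r)) *\<^sub>C T r f s - f s)
      = integral {0..h} (\<lambda>r. ?e *\<^sub>C ?F r - f s)"
  proof (rule integral_cong)
    fix r :: real
    have "exp (\<mu> * of_real (h - r)) = ?e * exp (- \<mu> * of_real r)"
      unfolding exp_add[symmetric] by (simp add: algebra_simps)
    then show "exp (\<mu> * of_real (h - r)) *\<^sub>C T r f s - f s = ?e *\<^sub>C ?F r - f s"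
      by (simp only: scaleC_scaleC)
  qed
  also have "\<dots> = integral {0..h} (\<lambda>r. ?e *\<^sub>C ?F r) - integral {0..h} (\<lambda>r. f s)"
    by (intro integral_diff integrable_continuous_real scaleC.continuous_on continuous_on_const F)
  also have "integral {0..h} (\<lambda>r. ?e *\<^sub>C ?F r) = ?e *\<^sub>C ?I"
    using integral_linear[OF integrable_continuous_real[OF F] scaleC.bounded_linear_right] unfolding o_def .
  also have "integral {0..h} (\<lambda>r. f s) = h *\<^sub>R f s" using h by simp
  finally have J: "integral {0..h} (\<lambda>r. exp (\<mu> * of_real (h - r)) *\<^sub>C T r f s - f s) = ?e *\<^sub>C ?I - h *\<^sub>R f s" .
  have "((?e - 1) / of_real h - \<mu>) *\<^sub>C ?u = (1 / h) *\<^sub>R (?e *\<^sub>C ?u - ?u) - \<mu> *\<^sub>C ?u"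
  proof -
    have "(1 / h) *\<^sub>R (?e *\<^sub>C ?u - ?u) = of_real (1 / h) *\<^sub>C ((?e - 1) *\<^sub>C ?u)"
      by (simp only: scaleC_of_real scaleC.diff_left scaleC_one)
    also have "\<dots> = ((?e - 1) / of_real h) *\<^sub>C ?u"
      by (simp add: scaleC_scaleC)
    finally show ?thesis by (simp only: scaleC.diff_left)
  qed
  then show ?thesis
    unfolding J T_laplace_resolvent[OF f less_imp_le[OF h] s]
    using h by (simp add: scaleC.diff_right scaleR_diff_right)
qed

lemma gen_value_laplace_resolvent:
  assumes f: "f \<in> V" and u: "laplace_resolvent \<mu> f \<in> V"
  shows "gen_value (laplace_resolvent \<mu> f) (\<lambda>i. \<mu> *\<^sub>C laplace_resolvent \<mu> f i - f i)"
  unfolding is_generator_value_def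
proof
  let ?u = "laplace_resolvent \<mu> f"
  let ?v = "\<lambda>i. \<mu> *\<^sub>C ?u i - f i"
  let ?E = "\<lambda>h i. (1 / h) *\<^sub>R (T h ?u i - ?u i) - ?v i"
  show v: "?v \<in> V" using f u by (intro V_diff V_scaleC)
  let ?a = "\<lambda>h. cmod ((exp (\<mu> * of_real h) - 1) / of_real h - \<mu>)"
  have E: "?E h \<in> V" if "0 < h" for h
    using u v that by (intro V_diff[of _ ?v] V_diff[of _ ?u] V_scaleR T_in_V) auto
  show "((\<lambda>h. N (?E h)) \<longlongrightarrow> 0) (at_right 0)"
  proof (rule tendstoI)
    fix e :: real assume e: "e > 0"
    define e' where "e' = e / 2"
    have e': "e' > 0" "e' < e" using e by (auto simp: e'_def)
    obtain d where d: "d > 0" "\<And>h. 0 \<le> h \<Longrightarrow> h < d \<Longrightarrow> N (\<lambda>s. T h f s - f s) \<le> e'"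
      by (rule T_strongly_continuous[OF f e'(1)]) blast
    let ?b = "\<lambda>h. exp (cmod \<mu> * h) * e' + exp (cmod \<mu> * h) * (cmod \<mu> * h) * N f"
    have "(?a \<longlongrightarrow> 0) (at_right 0)"
      using tendsto_exp_difference_quotient[of \<mu>] by (intro tendsto_norm_zero) (simp add: LIM_zero_iff)
    then have "((\<lambda>h. ?a h * N ?u + ?b h) \<longlongrightarrow> 0 * N ?u + (exp (cmod \<mu> * 0) * e' + exp (cmod \<mu> * 0) * (cmod \<mu> * 0) * N f)) (at_right 0)"
      by (intro tendsto_intros)
    then have lim: "((\<lambda>h. ?a h * N ?u + ?b h) \<longlongrightarrow> e') (at_right 0)" by simp
    have bound: "N (?E h) \<le> ?a h * N ?u + ?b h" if h: "0 < h" "h < d" for h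
    proof (rule N_least)
      fix s :: real assume s: "0 \<le> s"
      let ?J = "integral {0..h} (\<lambda>r. exp (\<mu> * of_real (h - r)) *\<^sub>C T r f s - f s)"
      have "lyap s ?J \<le> integral {0..h} (\<lambda>r. ?b h)"
      proof (rule lyap_integral[OF s])
        show "continuous_on {0..h} (\<lambda>r. exp (\<mu> * of_real (h - r)) *\<^sub>C T r f s - f s)"
          by (intro scaleC.continuous_on T_continuous[OF f] continuous_intros) (use s in auto)
        fix r assume r: "r \<in> {0..h}"
        let ?c = "exp (\<mu> * of_real (h - r))"
        have w: "cmod (\<mu> * of_real (h - r)) \<le> cmod \<mu> * h"
          unfolding norm_mult norm_of_real using r by (intro mult_left_mono) auto
        have c: "cmod ?c \<le> exp (cmod \<mu> * h)"
          using norm_exp[of "\<mu> * of_real (h - r)"] w by (meson exp_le_cancel_iff order_trans)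
        have c1: "cmod (?c - 1) \<le> exp (cmod \<mu> * h) * (cmod \<mu> * h)"
          by (rule order_trans[OF norm_exp_minus_one_le mult_mono]) (use w in auto)
        have V': "(\<lambda>s. T r f s - f s) \<in> V" using f r by (intro V_diff T_in_V) auto
        have "?c *\<^sub>C T r f s - f s = ?c *\<^sub>C (T r f s - f s) + (?c - 1) *\<^sub>C f s"
          by (simp add: scaleC.diff_right scaleC.diff_left)
        then have "lyap s (?c *\<^sub>C T r f s - f s) \<le> cmod ?c * lyap s (T r f s - f s) + cmod (?c - 1) * lyap s (f s)"
          using lyap_add[OF s] by (metis lyap_scaleC[OF s])
        also have "\<dots> \<le> ?b h"
        proof (intro add_mono mult_mono c c1 lyap_le_N[OF f s] lyap_nonneg s)
          show "lyap s (T r f s - f s) \<le> e'"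
            using lyap_le_N[OF V' s] d(2)[of r] r h by simp
        qed (use h in auto)
        finally show "lyap s (?c *\<^sub>C T r f s - f s) \<le> ?b h" .
      qed (rule integrable_const_ivl)
      then have J: "lyap s ?J \<le> h * ?b h" using h by simp
      have "lyap s (?E h s) \<le> ?a h * lyap s (?u s) + (1 / h) * lyap s ?J"
        unfolding difference_quotient_of_laplace_resolvent[OF f h(1) s]
        by (rule order_trans[OF lyap_diff[OF s]]) (use h in \<open>simp add: lyap_scaleC[OF s] lyap_scaleR[OF s]\<close>)
      also have "\<dots> \<le> ?a h * N ?u + (1 / h) * (h * ?b h)"
        using J h by (intro add_mono mult_left_mono lyap_le_N[OF u s]) auto
      also have "(1 / h) * (h * ?b h) = ?b h" using h by simp
      finally show "lyap s (?E h s) \<le> ?a h * N ?u + ?b h" .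
    qed
    have "\<forall>\<^sub>F h in at_right 0. ?a h * N ?u + ?b h < e" using lim e'(2) by (rule order_tendstoD(2))
    moreover have "\<forall>\<^sub>F h in at_right 0. h \<in> {0<..<d}" using d(1) by (rule eventually_at_right_real)
    ultimately show "\<forall>\<^sub>F h in at_right 0. dist (N (?E h)) 0 < e"
    proof eventually_elim
      case (elim h)
      then show ?case using bound[of h] N_nonneg[OF E[of h]] by simp
    qed
  qed
qed

lemma resolvent_of_generator_if_growth:
  assumes g: "growth \<omega>" and \<omega>: "\<omega> < Re \<mu>"
  shows "\<mu> \<in> resolvent_set V N gen_dom gen"
proof -
  obtain C where C: "0 \<le> C"
    and growth: "\<And>a s x. 0 \<le> a \<Longrightarrow> a \<le> s \<Longrightarrow> lyap s (U s a x) \<le> C * exp (\<omega> * (s - a)) * lyap a x"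
    using g unfolding growth_def by blast
  have in_V: "laplace_resolvent \<mu> f \<in> V" if "f \<in> V" for f
    by (rule laplace_resolvent_in_V[OF that C growth \<omega>])
  have gval: "gen_value (laplace_resolvent \<mu> f) (\<lambda>i. \<mu> *\<^sub>C laplace_resolvent \<mu> f i - f i)" if "f \<in> V" for f
    by (rule gen_value_laplace_resolvent[OF that in_V[OF that]])
  show ?thesis
  proof (rule resolvent_setI[where S="laplace_resolvent \<mu>" and K="C / (Re \<mu> - \<omega>)"])
    show "(\<lambda>i. \<mu> *\<^sub>C u i - gen u i) \<in> V" if "u \<in> gen_dom" for u
      using gen_value_gen[OF that] by (intro V_diff V_scaleC) (auto simp: is_generator_value_def)
    show "laplace_resolvent \<mu> f \<in> gen_dom" if "f \<in> V" for f
      using in_V[OF that] gval[OF that] unfolding generator_domain_def by blast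
    show "(\<lambda>i. \<mu> *\<^sub>C laplace_resolvent \<mu> f i - gen (laplace_resolvent \<mu> f) i) = f" if "f \<in> V" for f
      unfolding gen_eq[OF in_V[OF that] gval[OF that]] by simp
    show "laplace_resolvent \<mu> (\<lambda>i. \<mu> *\<^sub>C u i - gen u i) = u" if "u \<in> gen_dom" for u
      using gen_value_gen[OF that] laplace_resolvent_of_gen_value by blast
    show "N (laplace_resolvent \<mu> f) \<le> C / (Re \<mu> - \<omega>) * N f" if "f \<in> V" for f
      by (rule N_laplace_resolvent_le[OF that C growth \<omega>])
  qed
qed

lemma laplace_resolvent_orbit_bump:
  assumes a: "0 \<le> a" and s: "a \<le> s" and l: "0 \<le> l"
  shows "laplace_resolvent \<mu> (orbit_bump \<mu> a l x) s
       = integral {0..s} (\<lambda>r. trapezoid a l (s - r)) *\<^sub>R (exp (- \<mu> * of_real (s - a)) *\<^sub>C U s a x)"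
proof -
  let ?y = "exp (- \<mu> * of_real (s - a)) *\<^sub>C U s a x"
  have "laplace_resolvent \<mu> (orbit_bump \<mu> a l x) s = integral {0..s} (\<lambda>r. trapezoid a l (s - r) *\<^sub>R ?y)"
    unfolding laplace_resolvent_def
    by (rule integral_cong) (simp only: T_orbit_bump[OF a s] atLeastAtMost_iff scaleC_of_real)
  also have "\<dots> = integral {0..s} (\<lambda>r. trapezoid a l (s - r)) *\<^sub>R ?y"
    using integral_linear[OF integrable_continuous_real[OF continuous_on_trapezoid]
        bounded_linear_scaleR_left[of ?y], of 0 s "\<lambda>r. s - r" a l]
    unfolding o_def by (simp add: continuous_intros)
  finally show ?thesis .
qed

lemma trapezoid_integral_ge:
  assumes "0 \<le> a" "2 \<le> l" "a + l \<le> s"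
  shows "l - 2 \<le> integral {0..s} (\<lambda>r. trapezoid a l (s - r))"
proof -
  \<comment> \<open>the interval on which \<open>s - r\<close> runs through the plateau\<close>
  let ?I = "{s - (a + l - 1)..s - (a + 1)}"
  have cont: "continuous_on A (\<lambda>r. trapezoid a l (s - r))" for A
    by (intro continuous_on_trapezoid continuous_intros)
  have "l - 2 = integral ?I (\<lambda>r. 1)" using assms(2) by simp
  also have "\<dots> = integral ?I (\<lambda>r. trapezoid a l (s - r))"
    by (rule integral_cong) (simp add: trapezoid_plateau)
  also have "\<dots> \<le> integral {0..s} (\<lambda>r. trapezoid a l (s - r))"
    by (rule integral_subset_le) (use assms trapezoid_bounds in \<open>auto intro!: integrable_continuous_real cont\<close>)
  finally show ?thesis .
qed

text \<open>As for the semigroup operators, except that the multiple of the orbit is now the integral of the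
  cut-off instead of a number of points.\<close>

lemma growth_if_resolvent_of_generator:
  assumes \<mu>: "\<mu> \<in> resolvent_set V N gen_dom gen"
  shows "\<exists>\<omega><Re \<mu>. growth \<omega>"
proof -
  have "laplace_resolvent \<mu> (\<lambda>i. \<mu> *\<^sub>C u i - gen u i) = u" if "u \<in> gen_dom" for u
    using gen_value_gen[OF that] laplace_resolvent_of_gen_value by blast
  then obtain K where K: "K \<ge> 0"
    "\<And>f. f \<in> V \<Longrightarrow> laplace_resolvent \<mu> f \<in> gen_dom \<and> N (laplace_resolvent \<mu> f) \<le> K * N f"
    using resolvent_setE[where S="laplace_resolvent \<mu>", OF \<mu> _ N_nonneg] by blast
  show ?thesis
  proof (rule growth_from_orbit_estimates[OF K(1)])
    fix m :: nat
    \<comment> \<open>again two ramps of length 1, so that the integral of the cut-off is at least \<open>m\<close>\<close>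
    define l where "l = real m + 2"
    have "m * (exp (- Re \<mu> * (s - a)) * lyap s (U s a x)) \<le> K * B"
      if a: "a \<ge> 0" and s: "s \<ge> a + l"
        and B: "\<forall>\<tau>\<in>{a..a + l}. exp (- Re \<mu> * (\<tau> - a)) * lyap \<tau> (U \<tau> a x) \<le> B" for a x s B
    proof -
      let ?f = "orbit_bump \<mu> a l x"
      let ?I = "integral {0..s} (\<lambda>r. trapezoid a l (s - r))"
      have s0: "0 \<le> s" "a \<le> s" "0 \<le> l" using a s by (auto simp: l_def)
      have f: "?f \<in> V" using orbit_bump_in_V a s0 by simp
      have m: "real m \<le> ?I" using trapezoid_integral_ge[OF a _ s] by (simp add: l_def)
      have "m * (exp (- Re \<mu> * (s - a)) * lyap s (U s a x)) \<le> ?I * (exp (- Re \<mu> * (s - a)) * lyap s (U s a x))"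
        using m lyap_nonneg[OF s0(1)] by (intro mult_right_mono) auto
      also have "\<dots> = lyap s (laplace_resolvent \<mu> ?f s)"
        unfolding laplace_resolvent_orbit_bump[OF a s0(2,3)] using m
        by (simp add: lyap_scaleC[OF s0(1)] lyap_scaleR[OF s0(1)])
      also have "\<dots> \<le> N (laplace_resolvent \<mu> ?f)"
        using K(2)[OF f] gen_value_gen by (intro lyap_le_N s0) blast
      also have "\<dots> \<le> K * N ?f" using K(2)[OF f] by blast
      also have "\<dots> \<le> K * B" using K(1) N_orbit_bump_le[OF a s0(3) B] by (intro mult_left_mono)
      finally show ?thesis .
    qed
    moreover have "l > 0" by (simp add: l_def)
    ultimately show "\<exists>l>0. \<forall>a\<ge>0. \<forall>x. \<forall>s\<ge>a + l. \<forall>B.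
          (\<forall>\<tau>\<in>{a..a + l}. exp (- Re \<mu> * (\<tau> - a)) * lyap \<tau> (U \<tau> a x) \<le> B) \<longrightarrow>
          m * (exp (- Re \<mu> * (s - a)) * lyap s (U s a x)) \<le> K * B"
      by blast
  qed
qed

section \<open>The two spectra\<close>

lemma spectrum_generator_eq:
  "spectrum_generator U \<alpha> = {\<mu>. \<forall>\<omega>. growth \<omega> \<longrightarrow> Re \<mu> \<le> \<omega>}"
proof -
  have "\<mu> \<in> resolvent_set V N gen_dom gen \<longleftrightarrow> (\<exists>\<omega><Re \<mu>. growth \<omega>)" for \<mu>
    using growth_if_resolvent_of_generator resolvent_of_generator_if_growth by blast
  then show ?thesis
    unfolding spectrum_generator_def spectrum_def by (simp add: set_eq_iff) (meson not_less)
qed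

lemma nonzero_spectrum_semigroup_eq:
  assumes t: "t > 0"
  shows "spectrum_semigroup U \<alpha> t - {0} = {z. z \<noteq> 0 \<and> (\<forall>\<omega>. growth \<omega> \<longrightarrow> cmod z \<le> exp (\<omega> * t))}"
proof -
  have "z \<in> resolvent_set V N V (T t) \<longleftrightarrow> (\<exists>\<omega>. growth \<omega> \<and> exp (\<omega> * t) < cmod z)" if "z \<noteq> 0" for z
    using growth_if_resolvent_of_semigroup[OF t that] resolvent_of_semigroup_if_growth[OF t] by blast
  then show ?thesis
    unfolding spectrum_semigroup_def spectrum_def by (simp add: set_eq_iff) (meson not_less)
qed

text \<open>The modulus of \<open>exp (t \<mu>)\<close> is \<open>exp (t Re \<mu>)\<close>, so that the two conditions in terms of
  \<open>growth\<close> correspond; surjectivity uses the principal logarithm.\<close>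

lemma exp_spectrum_generator:
  assumes t: "t > 0"
  shows "(\<lambda>z. exp (complex_of_real t * z)) ` spectrum_generator U \<alpha> = spectrum_semigroup U \<alpha> t - {0}"
proof
  show "(\<lambda>z. exp (complex_of_real t * z)) ` spectrum_generator U \<alpha> \<subseteq> spectrum_semigroup U \<alpha> t - {0}"
    unfolding nonzero_spectrum_semigroup_eq[OF t] spectrum_generator_eq
    using t by (auto simp: mult.commute)
  show "spectrum_semigroup U \<alpha> t - {0} \<subseteq> (\<lambda>z. exp (complex_of_real t * z)) ` spectrum_generator U \<alpha>"
  proof
    fix z assume "z \<in> spectrum_semigroup U \<alpha> t - {0}"
    then have z: "z \<noteq> 0" "\<And>\<omega>. growth \<omega> \<Longrightarrow> cmod z \<le> exp (\<omega> * t)"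
      unfolding nonzero_spectrum_semigroup_eq[OF t] by auto
    have "Re (Ln z / of_real t) \<le> \<omega>" if "growth \<omega>" for \<omega>
      using z that Re_Ln_scaled_le_iff[OF t] by blast
    then have "Ln z / of_real t \<in> spectrum_generator U \<alpha>" by (simp add: spectrum_generator_eq)
    moreover have "z = exp (of_real t * (Ln z / of_real t))" using t z(1) by simp
    ultimately show "z \<in> (\<lambda>z. exp (complex_of_real t * z)) ` spectrum_generator U \<alpha>" by blast
  qed
qed

text \<open>The abscissa is the infimum of the growth exponents; the spectrum is empty when they are
  unbounded below.\<close>

lemma spectrum_generator_cases:
  obtains "spectrum_generator U \<alpha> = {}" | \<omega> where "spectrum_generator U \<alpha> = {z. Re z \<le> \<omega>}"
proof (cases "bdd_below {\<omega>. growth \<omega>}")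
  case True
  have "{\<omega>. growth \<omega>} \<noteq> {}" using growth_alpha by blast
  then have "(\<forall>\<omega>. growth \<omega> \<longrightarrow> r \<le> \<omega>) \<longleftrightarrow> r \<le> Inf {\<omega>. growth \<omega>}" for r
    using le_cInf_iff[OF _ True] by auto
  then show ?thesis using that(2) by (simp add: spectrum_generator_eq)
next
  case False
  have "\<mu> \<notin> spectrum_generator U \<alpha>" for \<mu>
    using False unfolding spectrum_generator_eq by (auto intro: bdd_belowI)
  then show ?thesis using that(1) by blast
qed

lemma bump_in_V: "0 \<le> l \<Longrightarrow> (\<lambda>s. trapezoid 0 l s *\<^sub>R x) \<in> V"
proof (rule V_intro)
  show "continuous_on {0..} (\<lambda>s. trapezoid 0 l s *\<^sub>R x)"
    by (intro continuous_intros continuous_on_trapezoid)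
  fix e :: real assume "e > 0"
  then have "lyap t (trapezoid 0 l t *\<^sub>R x) \<le> e" if "l \<le> t" "0 \<le> t" for t
    using that by (simp add: trapezoid_outside lyap_zero)
  then show "\<exists>S. \<forall>t\<ge>S. t \<ge> 0 \<longrightarrow> lyap t (trapezoid 0 l t *\<^sub>R x) \<le> e" by blast
qed (simp_all add: trapezoid_outside)

text \<open>A function that does not vanish at \<open>t\<close> is not in the range of \<open>T t\<close>.\<close>

lemma zero_in_spectrum_semigroup:
  assumes t: "t > 0" and x: "(x::'a) \<noteq> 0"
  shows "0 \<in> spectrum_semigroup U \<alpha> t"
proof (rule ccontr)
  assume "0 \<notin> spectrum_semigroup U \<alpha> t"
  then have "bij_betw (\<lambda>u i. 0 *\<^sub>C u i - T t u i) V V"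
    unfolding spectrum_semigroup_def spectrum_def resolvent_set_def by auto
  then have "(\<lambda>s. trapezoid 0 (t + 1) s *\<^sub>R x) \<in> (\<lambda>u i. 0 *\<^sub>C u i - T t u i) ` V"
    using bump_in_V[of "t + 1" x] t by (simp add: bij_betw_def)
  then obtain u where "(\<lambda>s. trapezoid 0 (t + 1) s *\<^sub>R x) = (\<lambda>i. 0 *\<^sub>C u i - T t u i)" by blast
  then have "trapezoid 0 (t + 1) t *\<^sub>R x = 0 *\<^sub>C u t - T t u t" by (rule fun_cong)
  then have "trapezoid 0 (t + 1) t *\<^sub>R x = 0" by (simp add: T_before scaleC.zero_left)
  moreover have "trapezoid 0 (t + 1) t > 0" using t by (simp add: trapezoid_def)
  ultimately show False using x by simp
qed

lemma spectrum_semigroup_0: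
  assumes x: "(x::'a) \<noteq> 0"
  shows "spectrum_semigroup U \<alpha> 0 = {1}"
proof -
  have T0: "z *\<^sub>C u i - T 0 u i = (z - 1) *\<^sub>C u i" if "u \<in> V" for z u i
    using T_0[OF that] by (simp add: scaleC.diff_left)
  have "z \<in> resolvent_set V N V (T 0)" if z: "z \<noteq> 1" for z
  proof (rule resolvent_setI[where S="\<lambda>f i. inverse (z - 1) *\<^sub>C f i" and K="cmod (inverse (z - 1))"])
    show S: "(\<lambda>i. inverse (z - 1) *\<^sub>C f i) \<in> V" if "f \<in> V" for f by (rule V_scaleC[OF that])
    show "(\<lambda>i. z *\<^sub>C u i - T 0 u i) \<in> V" if "u \<in> V" for u
      using V_scaleC[OF that, of "z - 1"] by (simp add: T0[OF that])
    show "(\<lambda>i. z *\<^sub>C (inverse (z - 1) *\<^sub>C f i) - T 0 (\<lambda>i. inverse (z - 1) *\<^sub>C f i) i) = f" if "f \<in> V" for f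
      unfolding T0[OF S[OF that]] unfolding scaleC_scaleC using z by simp
    show "(\<lambda>i. inverse (z - 1) *\<^sub>C (z *\<^sub>C u i - T 0 u i)) = u" if "u \<in> V" for u
      using z by (simp add: T0[OF that] scaleC_scaleC)
    show "N (\<lambda>i. inverse (z - 1) *\<^sub>C f i) \<le> cmod (inverse (z - 1)) * N f" if "f \<in> V" for f
    proof (rule N_least)
      fix s :: real assume s: "0 \<le> s"
      show "lyap s (inverse (z - 1) *\<^sub>C f s) \<le> cmod (inverse (z - 1)) * N f"
        unfolding lyap_scaleC[OF s] by (intro mult_left_mono lyap_le_N[OF that s]) simp
    qed
  qed
  moreover have "1 \<notin> resolvent_set V N V (T 0)"
  proof
    assume "1 \<in> resolvent_set V N V (T 0)"
    then have inj: "inj_on (\<lambda>u i. 1 *\<^sub>C u i - T 0 u i) V"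
      unfolding resolvent_set_def by (auto simp: bij_betw_def)
    let ?u = "\<lambda>s. trapezoid 0 2 s *\<^sub>R x" and ?v = "\<lambda>s. trapezoid 0 2 s *\<^sub>R (0 :: 'a)"
    have V: "?u \<in> V" "?v \<in> V" by (intro bump_in_V; simp)+
    have "?u = ?v" by (rule inj_onD[OF inj _ V]) (simp only: T0[OF V(1)] T0[OF V(2)] scaleC.zero_left diff_self)
    then have "trapezoid 0 2 1 *\<^sub>R x = 0" by (metis scaleR_zero_right)
    then show False using x by (simp add: trapezoid_def)
  qed
  ultimately show ?thesis unfolding spectrum_semigroup_def spectrum_def by auto
qed

text \<open>On the zero space every exponent is a growth exponent. Thus a nonempty spectrum at \<open>t = 0\<close>
  guarantees a nonzero vector.\<close>

lemma spectrum_generator_trivial: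
  assumes "\<And>x::'a. x = 0"
  shows "spectrum_generator U \<alpha> = {}"
proof -
  have "U s a x = 0" for s a x by (rule assms)
  then have "growth \<omega>" for \<omega>
    unfolding growth_def by (intro exI[of _ 1]) (auto simp: lyap_zero lyap_nonneg)
  have "\<mu> \<notin> spectrum_generator U \<alpha>" for \<mu>
    unfolding spectrum_generator_eq using \<open>growth (Re \<mu> - 1)\<close> by force
  then show ?thesis by blast
qed

lemma spectrum_semigroup_is_disc:
  assumes x: "(x::'a) \<noteq> 0" and t: "0 \<le> t"
  shows "is_disc (spectrum_semigroup U \<alpha> t)"
proof (cases "t = 0")
  case True
  then have "spectrum_semigroup U \<alpha> t = cball 1 0" using spectrum_semigroup_0[OF x] by simp
  then show ?thesis unfolding is_disc_def by blast
next
  case False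
  then have t: "t > 0" using t by simp
  have eq: "spectrum_semigroup U \<alpha> t = insert 0 ((\<lambda>z. exp (complex_of_real t * z)) ` spectrum_generator U \<alpha>)"
    unfolding exp_spectrum_generator[OF t] using zero_in_spectrum_semigroup[OF t x] by auto
  show ?thesis
  proof (rule spectrum_generator_cases)
    assume "spectrum_generator U \<alpha> = {}"
    then have "spectrum_semigroup U \<alpha> t = cball 0 0" using eq by simp
    then show ?thesis unfolding is_disc_def by blast
  next
    fix \<omega> assume "spectrum_generator U \<alpha> = {z. Re z \<le> \<omega>}"
    then have "spectrum_semigroup U \<alpha> t = cball 0 (exp (\<omega> * t))"
      unfolding eq by (auto simp: exp_image_half_plane[OF t])
    then show ?thesis unfolding is_disc_def by (metis exp_ge_zero)
  qed
qed
end

theorem theorem3p5: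
  fixes U :: "real \<Rightarrow> real \<Rightarrow> 'a::cbanach \<Rightarrow> 'a" and \<alpha> :: real
  assumes "evolution_family U"
    and "nonuniform_exponentially_bounded U"
    and "\<alpha> \<in> admissible_exponents U"
  shows "(\<forall>t\<ge>0. (t = 0 \<longrightarrow> spectrum_generator U \<alpha> \<noteq> {}) \<longrightarrow>
            (\<lambda>z. exp (complex_of_real t * z)) ` spectrum_generator U \<alpha>
              = spectrum_semigroup U \<alpha> t - {0})
       \<and> is_left_half_plane (spectrum_generator U \<alpha>)
       \<and> ((\<exists>x::'a. x \<noteq> 0) \<longrightarrow> (\<forall>t\<ge>0. is_disc (spectrum_semigroup U \<alpha> t)))"
proof -
  obtain M where "continuous_on {0..} M"
    "\<And>t s. 0 \<le> s \<Longrightarrow> s \<le> t \<Longrightarrow> onorm (U t s) \<le> M s * exp (\<alpha> * (t - s))"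
    using assms(3) unfolding admissible_exponents_def by blast
  then interpret evolution_setting U \<alpha> M by unfold_locales (use assms(1) in auto)
  have "(\<lambda>z. exp (complex_of_real t * z)) ` spectrum_generator U \<alpha> = spectrum_semigroup U \<alpha> t - {0}"
    if "t \<ge> 0" and ne: "t = 0 \<longrightarrow> spectrum_generator U \<alpha> \<noteq> {}" for t
  proof (cases "t = 0")
    case True
    then obtain x :: 'a where "x \<noteq> 0" using ne spectrum_generator_trivial by blast
    then show ?thesis using True ne spectrum_semigroup_0[OF \<open>x \<noteq> 0\<close>] by (simp add: image_constant_conv)
  next
    case False
    then show ?thesis using that(1) by (intro exp_spectrum_generator) simp
  qed
  moreover have "is_left_half_plane (spectrum_generator U \<alpha>)"
    by (rule spectrum_generator_cases) (auto simp: is_left_half_plane_def)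
  ultimately show ?thesis using spectrum_semigroup_is_disc by blast
qed

end
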